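(* Let $\Omega\subset\mathbb{R}^n$ be an open and bounded domain which admits a perimeter bound for its inner parallel bodies. Let $d(x)=\operatorname{dist}(x,\partial\Omega)$ and $r=\max_{x\in\Omega}d(x)$. Let $t_*>0$ and let $g$ be a solution on $[0,t_*]$ of $$g'(t)=\frac{g(t)^2}{I_2(g(t))},\quad t>0,\qquad g(0)=0,$$ such that the function $$u(t,x)=\begin{cases}\min\left(\dfrac{1}{g(t)}d(x),\,r\right), & 0\le t<t_*,\\[2mm] \dfrac{1}{\|d\|_2^2}\left(\|d\|_2^2+t_*-t\right)_+ d(x), & t\ge t_*,\end{cases}$$ solves the gradient flow $u'(t)+\partial\mathcal{J}(u(t))\ni 0$, $u(0)=f$ with $f\equiv r$. Then for every $t>0$ the function $u(t,\cdot)$ is the unique solution of $$\min_{v\in W^{1,\infty}_0(\Omega)}\ \frac12\|v-f\|_2^2+t\,\|\nabla v\|_\infty,\qquad f\equiv r.$$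
   Context: Inner parallel bodies: $\Omega_\tau=\{x\in\Omega: d(x)\ge\tau\}$; $P(\cdot)$ denotes the perimeter. $\Omega$ admits a perimeter bound for its inner parallel bodies if there are $\tilde r>0$ and $0<\tilde\tau\le\tilde r$ with $P(\Omega_\tau)\ge P(\Omega)\left(1-\frac{\tau}{\tilde r}\right)^{n-1}$ for all $0\le\tau\le\tilde\tau$. $I_2(g)=\int_{\Omega\setminus\Omega_{rg}}d(x)^2\,\mathrm{d}x$ for $0\le g\le 1$. $(a)_+=\max(a,0)$. $W^{1,\infty}_0(\Omega)=\{u\in W^{1,\infty}(\Omega): u=0\text{ on }\partial\Omega\}$; $\mathcal{J}:L^2(\Omega)\to[0,\infty]$ is $\mathcal{J}(u)=\|\nabla u\|_\infty$ if $u\in W^{1,\infty}_0(\Omega)$ and $+\infty$ otherwise; $\partial\mathcal{J}$ is its convex subdifferential in $L^2(\Omega)$, and the gradient flow is understood in $L^2(\Omega)$. *)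

theory Defs
  imports "HOL-Analysis.Analysis" "HOL-Probability.Essential_Supremum"
begin

section \<open>Test functions, weak gradients, perimeter\<close>

text \<open>The space \<open>C\<^sub>c\<^sup>1(U)\<close>, for scalar and vector valued functions; its elements are total
  functions vanishing outside a compact subset of \<open>U\<close>.\<close>

definition C1c :: "'a::euclidean_space set \<Rightarrow> ('a \<Rightarrow> 'b::euclidean_space) set" where
  "C1c U = {\<phi>. (\<forall>x. \<phi> differentiable (at x)) \<and>
               (\<forall>h. continuous_on UNIV (\<lambda>x. frechet_derivative \<phi> (at x) h)) \<and>
               compact (closure {x. \<phi> x \<noteq> 0}) \<and> closure {x. \<phi> x \<noteq> 0} \<subseteq> U}"

definition divergence :: "('a::euclidean_space \<Rightarrow> 'a) \<Rightarrow> 'a \<Rightarrow> real" where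
  "divergence \<phi> x = (\<Sum>i\<in>Basis. frechet_derivative \<phi> (at x) i \<bullet> i)"

text \<open>De Giorgi perimeter in the whole space. The negative part cut off by \<^const>\<open>ennreal\<close> is
  irrelevant, as \<open>\<phi> = 0\<close> is admissible.\<close>

definition perimeter :: "'a::euclidean_space set \<Rightarrow> ennreal" where
  "perimeter E = (SUP \<phi>\<in>{\<phi> \<in> C1c UNIV. \<forall>x. norm (\<phi> x) \<le> 1}.
      ennreal (set_lebesgue_integral lebesgue E (divergence \<phi>)))"

definition locally_integrable :: "'a::euclidean_space set \<Rightarrow> ('a \<Rightarrow> 'b::euclidean_space) \<Rightarrow> bool" where
  "locally_integrable U f \<longleftrightarrow> (\<forall>K. compact K \<and> K \<subseteq> U \<longrightarrow> set_integrable lebesgue K f)"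

definition has_weak_gradient ::
  "'a::euclidean_space set \<Rightarrow> ('a \<Rightarrow> real) \<Rightarrow> ('a \<Rightarrow> 'a) \<Rightarrow> bool" where
  "has_weak_gradient U u G \<longleftrightarrow> locally_integrable U u \<and> locally_integrable U G \<and>
     (\<forall>\<phi>\<in>C1c U. \<forall>i\<in>Basis.
        set_lebesgue_integral lebesgue U (\<lambda>x. u x * frechet_derivative \<phi> (at x) i)
        = - set_lebesgue_integral lebesgue U (\<lambda>x. (G x \<bullet> i) * \<phi> x))"

text \<open>The weak gradient is unique up to null sets.\<close>

definition weak_gradient :: "'a::euclidean_space set \<Rightarrow> ('a \<Rightarrow> real) \<Rightarrow> 'a \<Rightarrow> 'a" where
  "weak_gradient U u = (SOME G. has_weak_gradient U u G)"

section \<open>Function spaces\<close>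

text \<open>Elements of \<open>L\<^sup>2(U)\<close> and \<open>W\<^sup>1\<^sup>,\<^sup>\<infinity>(U)\<close> are represented by functions; two functions
  represent the same element if they agree almost everywhere on \<open>U\<close>. Values outside \<open>U\<close> are
  irrelevant.\<close>

definition L2 :: "'a::euclidean_space set \<Rightarrow> ('a \<Rightarrow> real) set" where
  "L2 U = {f \<in> borel_measurable (lebesgue_on U). integrable (lebesgue_on U) (\<lambda>x. (f x)\<^sup>2)}"

definition L2_inner :: "'a::euclidean_space set \<Rightarrow> ('a \<Rightarrow> real) \<Rightarrow> ('a \<Rightarrow> real) \<Rightarrow> real" where
  "L2_inner U f g = (LINT x|lebesgue_on U. f x * g x)"

definition L2_norm :: "'a::euclidean_space set \<Rightarrow> ('a \<Rightarrow> real) \<Rightarrow> real" where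
  "L2_norm U f = sqrt (LINT x|lebesgue_on U. (f x)\<^sup>2)"

definition Linf_norm :: "'a::euclidean_space set \<Rightarrow> ('a \<Rightarrow> 'b::euclidean_space) \<Rightarrow> ereal" where
  "Linf_norm U f = esssup (lebesgue_on U) (\<lambda>x. ereal (norm (f x)))"

definition W1inf :: "'a::euclidean_space set \<Rightarrow> ('a \<Rightarrow> real) set" where
  "W1inf U = {u \<in> borel_measurable (lebesgue_on U). Linf_norm U u < \<infinity> \<and>
                (\<exists>G. has_weak_gradient U u G) \<and> Linf_norm U (weak_gradient U u) < \<infinity>}"

text \<open>\<open>u = 0\<close> on \<open>\<partial>U\<close> means that the continuous representative of \<open>u\<close> extends continuously by
  zero to the boundary; no regularity of \<open>\<partial>U\<close> is needed for this.\<close>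

definition W1inf0 :: "'a::euclidean_space set \<Rightarrow> ('a \<Rightarrow> real) set" where
  "W1inf0 U = {u \<in> W1inf U. \<exists>v. continuous_on (closure U) v \<and> (\<forall>x\<in>frontier U. v x = 0) \<and>
                 (AE x in lebesgue_on U. u x = v x)}"

section \<open>The functional, its subdifferential and gradient flows in \<open>L\<^sup>2\<close>\<close>

definition J :: "'a::euclidean_space set \<Rightarrow> ('a \<Rightarrow> real) \<Rightarrow> ereal" where
  "J U u = (if u \<in> W1inf0 U then Linf_norm U (weak_gradient U u) else \<infinity>)"

text \<open>For proper \<open>F\<close> this is empty where \<open>F u = \<infinity>\<close>.\<close>

definition subdifferential ::
  "'a::euclidean_space set \<Rightarrow> (('a \<Rightarrow> real) \<Rightarrow> ereal) \<Rightarrow> ('a \<Rightarrow> real) \<Rightarrow> ('a \<Rightarrow> real) set" where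
  "subdifferential U F u = {p \<in> L2 U. \<forall>v\<in>L2 U. F u + ereal (L2_inner U p (\<lambda>x. v x - u x)) \<le> F v}"

definition L2_continuous_on ::
  "'a::euclidean_space set \<Rightarrow> real set \<Rightarrow> (real \<Rightarrow> 'a \<Rightarrow> real) \<Rightarrow> bool" where
  "L2_continuous_on U T u \<longleftrightarrow>
     (\<forall>t\<in>T. ((\<lambda>s. L2_norm U (\<lambda>x. u s x - u t x)) \<longlongrightarrow> 0) (at t within T))"

text \<open>Absolute continuity of a curve: its increments are bounded by the integral of an
  \<open>L\<^sup>1\<close> function of time.\<close>

definition L2_abs_continuous_on ::
  "'a::euclidean_space set \<Rightarrow> real \<Rightarrow> real \<Rightarrow> (real \<Rightarrow> 'a \<Rightarrow> real) \<Rightarrow> bool" where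
  "L2_abs_continuous_on U a b u \<longleftrightarrow> (\<exists>m. set_integrable lebesgue {a..b} m \<and>
     (\<forall>s t. a \<le> s \<and> s \<le> t \<and> t \<le> b \<longrightarrow>
        L2_norm U (\<lambda>x. u t x - u s x) \<le> set_lebesgue_integral lebesgue {s..t} m))"

definition L2_has_derivative ::
  "'a::euclidean_space set \<Rightarrow> (real \<Rightarrow> 'a \<Rightarrow> real) \<Rightarrow> ('a \<Rightarrow> real) \<Rightarrow> real \<Rightarrow> bool" where
  "L2_has_derivative U u w t \<longleftrightarrow> w \<in> L2 U \<and>
     ((\<lambda>s. L2_norm U (\<lambda>x. (u s x - u t x) / (s - t) - w x)) \<longlongrightarrow> 0) (at t)"

text \<open>\<open>u' + \<partial>F(u) \<ni> 0\<close>, \<open>u(0) = f\<close> in the usual strong sense. The datum \<open>f\<close> only needs to lie in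
  the closure of the domain of \<open>F\<close>, hence local absolute continuity on the open half line only.\<close>

definition gradient_flow_solution ::
  "'a::euclidean_space set \<Rightarrow> (('a \<Rightarrow> real) \<Rightarrow> ereal) \<Rightarrow> ('a \<Rightarrow> real) \<Rightarrow> (real \<Rightarrow> 'a \<Rightarrow> real) \<Rightarrow> bool" where
  "gradient_flow_solution U F f u \<longleftrightarrow>
     (\<forall>t\<ge>0. u t \<in> L2 U) \<and>
     L2_continuous_on U {0..} u \<and>
     (\<forall>a b. 0 < a \<and> a \<le> b \<longrightarrow> L2_abs_continuous_on U a b u) \<and>
     (AE t in lebesgue. 0 < t \<longrightarrow>
        (\<exists>w. L2_has_derivative U u w t \<and> (\<lambda>x. - w x) \<in> subdifferential U F (u t))) \<and>
     (AE x in lebesgue_on U. u 0 x = f x)"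

section \<open>Distance function and inner parallel bodies\<close>

definition bdist :: "'a::euclidean_space set \<Rightarrow> 'a \<Rightarrow> real" where
  "bdist U x = infdist x (frontier U)"

text \<open>The supremum is a maximum for bounded, nonempty, open \<open>U\<close>.\<close>

definition inradius :: "'a::euclidean_space set \<Rightarrow> real" where
  "inradius U = (SUP x\<in>U. bdist U x)"

definition inner_parallel :: "'a::euclidean_space set \<Rightarrow> real \<Rightarrow> 'a set" where
  "inner_parallel U \<tau> = {x \<in> U. bdist U x \<ge> \<tau>}"

definition admits_perimeter_bound :: "'a::euclidean_space set \<Rightarrow> bool" where
  "admits_perimeter_bound U \<longleftrightarrow> (\<exists>r' > 0. \<exists>\<tau>'. 0 < \<tau>' \<and> \<tau>' \<le> r' \<and>
     (\<forall>\<tau>. 0 \<le> \<tau> \<and> \<tau> \<le> \<tau>' \<longrightarrow>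
        perimeter (inner_parallel U \<tau>) \<ge> perimeter U * ennreal ((1 - \<tau> / r') ^ (DIM('a) - 1))))"

definition I2 :: "'a::euclidean_space set \<Rightarrow> real \<Rightarrow> real" where
  "I2 U g = set_lebesgue_integral lebesgue (U - inner_parallel U (inradius U * g)) (\<lambda>x. (bdist U x)\<^sup>2)"

text \<open>Solutions take values in \<open>[0, 1]\<close>, where \<^const>\<open>I2\<close> is considered. The right hand side has
  to be meaningful, so \<open>I2 U (g t) \<noteq> 0\<close> is part of the equation; this excludes the
  spurious solution \<open>g = 0\<close> caused by \<open>0 / 0 = 0\<close>.\<close>

definition ode_solution :: "'a::euclidean_space set \<Rightarrow> real \<Rightarrow> (real \<Rightarrow> real) \<Rightarrow> bool" where
  "ode_solution U T g \<longleftrightarrow> continuous_on {0..T} g \<and> g 0 = 0 \<and> g ` {0..T} \<subseteq> {0..1} \<and>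
     (\<forall>t\<in>{0<..T}. I2 U (g t) \<noteq> 0 \<and>
        (g has_real_derivative (g t)\<^sup>2 / I2 U (g t)) (at t within {0..T}))"

text \<open>At \<open>g t = 0\<close> (that is, at \<open>t = 0\<close>) the quotient \<open>d(x) / g(t)\<close> is read as \<open>\<infinity>\<close>, so that the
  minimum with \<open>r\<close> is \<open>r\<close>.\<close>

definition flow :: "'a::euclidean_space set \<Rightarrow> real \<Rightarrow> (real \<Rightarrow> real) \<Rightarrow> real \<Rightarrow> 'a \<Rightarrow> real" where
  "flow U T g t x =
     (if t < T
      then (if g t = 0 then inradius U else min (1 / g t * bdist U x) (inradius U))
      else 1 / (L2_norm U (bdist U))\<^sup>2 * max ((L2_norm U (bdist U))\<^sup>2 + T - t) 0 * bdist U x)"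

section \<open>The variational problem\<close>

definition energy :: "'a::euclidean_space set \<Rightarrow> ('a \<Rightarrow> real) \<Rightarrow> real \<Rightarrow> ('a \<Rightarrow> real) \<Rightarrow> ereal" where
  "energy U f t v = ereal (1/2 * (L2_norm U (\<lambda>x. v x - f x))\<^sup>2)
                    + ereal t * Linf_norm U (weak_gradient U v)"

definition minimizers :: "'a::euclidean_space set \<Rightarrow> ('a \<Rightarrow> real) \<Rightarrow> real \<Rightarrow> ('a \<Rightarrow> real) set" where
  "minimizers U f t = {v \<in> W1inf0 U. \<forall>w\<in>W1inf0 U. energy U f t v \<le> energy U f t w}"

end

theory Submission
  imports Defs
begin

text \<open>
  The functional \<open>J\<close> is subadditive, so every \<open>p \<in> \<partial>J(u)\<close> satisfies \<open>\<langle>p, v\<rangle> \<le> J(v)\<close> for all \<open>v\<close>. Integrating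
  \<open>- u'(s) \<in> \<partial>J(u(s))\<close> over \<open>[0, t]\<close> gives \<open>\<langle>f - u(t), v\<rangle> \<le> t J(v)\<close>. Hence \<open>(f - u(t)) / t \<in> \<partial>J(u(t))\<close>, which is
  the optimality condition, as soon as \<open>\<langle>f - u(t), u(t)\<rangle> \<ge> t J(u(t))\<close>. On the set where \<open>f \<noteq> u(t)\<close> the
  function \<open>u(t)\<close> is \<open>L(t) d\<close> with \<open>L(t)\<close> its Lipschitz constant, and \<open>J(u(t)) \<le> L(t)\<close>; so it suffices that
  \<open>\<langle>f - u(t), d\<rangle> \<ge> t\<close>, and by the equation for \<open>g\<close> the left hand side has derivative at least \<open>1\<close>.
  Strict convexity of the quadratic term yields uniqueness.
\<close>

section \<open>Increments of absolutely continuous functions\<close>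

text \<open>The flow is paired with a fixed \<open>v\<close> before anything is integrated, so that
  only real functions of time are differentiated. The constant datum does not vanish on the boundary
  and lies outside the domain of \<open>J\<close>; absolute continuity is therefore available on
  \<open>[a, t]\<close> with \<open>a > 0\<close> only, and the initial time needs a separate
  passage \<open>a \<rightarrow> 0\<close>. One lemma on increments serves both the upper bound for
  arbitrary \<open>v\<close> and the lower bound for \<open>v = d\<close>.

  Most of the work makes \<open>J\<close> accessible on Lipschitz functions.
  \<open>weak_gradient\<close> is a choice among all weak gradients, so \<open>J(u) \<le> L\<close>
  requires that one exists and that every one is bounded by \<open>L\<close> almost everywhere.
  Existence comes from weak compactness: difference quotients are bounded, and a weak limit of them
  is a gradient. The bound compares integrals against nonnegative test functions and applies the
  fundamental lemma of the calculus of variations. With constant 0 it becomes uniqueness, on which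
  the subadditivity of \<open>J\<close> rests.\<close>

lemma derivative_le_AE_imp_increment_le:
  fixes \<phi> m :: "real \<Rightarrow> real"
  assumes ab: "a \<le> b" and m: "set_integrable lebesgue {a..b} m"
    and incr: "\<And>s t. a \<le> s \<Longrightarrow> s \<le> t \<Longrightarrow> t \<le> b \<Longrightarrow>
                 \<phi> t - \<phi> s \<le> K * set_lebesgue_integral lebesgue {s..t} m"
    and der: "AE t in lebesgue. a < t \<and> t < b \<longrightarrow> (\<exists>D\<le>C. (\<phi> has_real_derivative D) (at t))"
  shows "\<phi> b - \<phi> a \<le> C * (b - a)"
proof (rule field_le_epsilon)
  fix \<epsilon>0 :: real assume "0 < \<epsilon>0"
  \<comment> \<open>The factor \<open>b - a + 1\<close> leaves room for two errors:
    \<open>\<epsilon> * (b - a)\<close> from the slopes and one more \<open>\<epsilon>\<close> from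
    the exceptional set.\<close>
  define \<epsilon> where "\<epsilon> = \<epsilon>0 / (b - a + 1)"
  have \<epsilon>: "\<epsilon> > 0" "\<epsilon> * (b - a) + \<epsilon> = \<epsilon>0"
  proof -
    have pos: "b - a + 1 > 0" using ab by simp
    then show "\<epsilon> > 0" using \<open>0 < \<epsilon>0\<close> by (simp add: \<epsilon>_def)
    have "\<epsilon> * (b - a) + \<epsilon> = \<epsilon> * (b - a + 1)" by (simp add: algebra_simps)
    then show "\<epsilon> * (b - a) + \<epsilon> = \<epsilon>0" using pos by (simp add: \<epsilon>_def)
  qed
  \<comment> \<open>\<open>M\<close> dominates \<open>K * m - C\<close> on the interval, so its
    integral over \<open>{s..t}\<close> bounds how far \<open>\<phi>\<close> outruns the slope
    \<open>C\<close> there, with no derivative involved.\<close>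
  define M where "M t = indicat_real {a..b} t * (\<bar>K * m t\<bar> + \<bar>C\<bar>)" for t
  have "integrable lebesgue (\<lambda>t. indicat_real {a..b} t *\<^sub>R m t)"
    using m by (simp add: set_integrable_def)
  then have "integrable lebesgue (\<lambda>t. \<bar>K * (indicat_real {a..b} t *\<^sub>R m t)\<bar> + \<bar>C\<bar> * indicat_real {a..b} t)"
    by (intro Bochner_Integration.integrable_add integrable_abs integrable_mult_right)
       (auto simp: integrable_indicator_iff emeasure_lborel_Icc_eq)
  moreover have "(\<lambda>t. \<bar>K * (indicat_real {a..b} t *\<^sub>R m t)\<bar> + \<bar>C\<bar> * indicat_real {a..b} t) = M"
    by (auto simp: M_def fun_eq_iff abs_mult indicator_def)
  ultimately have M: "integrable lebesgue M" by simp
  have M0: "M t \<ge> 0" for t by (simp add: M_def)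
  have [measurable]: "M \<in> borel_measurable lebesgue" using M by simp
  obtain N where N: "N \<in> null_sets lebesgue"
    and Nsub: "{t. \<not> (a < t \<and> t < b \<longrightarrow> (\<exists>D\<le>C. (\<phi> has_real_derivative D) (at t)))} \<subseteq> N"
    using der by (auto simp: eventually_ae_filter)
  \<comment> \<open>The derivative is controlled inside the open interval only, so the endpoints
    join the exceptional set.\<close>
  define N' where "N' = N \<union> {a, b}"
  have "{a,b} \<in> null_sets lebesgue" by (simp add: negligible_iff_null_sets[symmetric])
  then have N': "N' \<in> null_sets lebesgue" unfolding N'_def using N by blast
  have "\<exists>G. open G \<and> N' \<subseteq> G \<and> emeasure lebesgue G < ennreal ((1/2)^n)" for n
  proof -
    obtain G where G: "open G" "N' \<subseteq> G" "G - N' \<in> lmeasurable" "emeasure lebesgue (G - N') < ennreal ((1/2)^n)"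
      using sets_lebesgue_outer_open[of N' "(1/2)^n"] N' by (auto simp: null_sets_def)
    have "emeasure lebesgue (G - N') = emeasure lebesgue G"
      using N' G by (intro emeasure_Diff_null_set) auto
    with G show ?thesis by metis
  qed
  then obtain G where G: "\<And>n. open (G n)" "\<And>n. N' \<subseteq> G n" "\<And>n::nat. emeasure lebesgue (G n) < ennreal ((1/2)^n)"
    by metis
  have Gs: "G n \<in> sets lebesgue" for n using G(1) by auto
  have Glm: "G n \<in> lmeasurable" for n
    using Gs G(3)[of n] by (auto simp: fmeasurable_def less_top[symmetric] top_unique dest: less_trans[OF _ ennreal_less_top])
  have int: "integrable lebesgue (indicat_real (G n))" for n
    using Glm[of n] by (auto simp: integrable_indicator_iff fmeasurable_def)
  \<comment> \<open>The indicators of open sets around \<open>N'\<close> with measure tending to 0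
    vanish almost everywhere in the limit along a subsequence. Dominated convergence then makes the
    integral of \<open>M\<close> over one of these sets less than \<open>\<epsilon>\<close>.\<close>
  have "(\<lambda>n. LINT x|lebesgue. norm (indicat_real (G n) x)) \<longlonglongrightarrow> 0"
  proof (rule tendsto_sandwich[of "\<lambda>_. 0" _ _ "\<lambda>n. (1/2)^n"])
    show "(\<lambda>n. (1/2::real)^n) \<longlonglongrightarrow> 0" by (intro LIMSEQ_power_zero) auto
    have "measure lebesgue (G n) \<le> (1/2)^n" for n
      using G(3)[of n] Glm[of n] by (simp add: emeasure_eq_measure2 ennreal_less_iff)
    then show "\<forall>\<^sub>F n in sequentially. (LINT x|lebesgue. norm (indicat_real (G n) x)) \<le> (1/2)^n"
      using Gs by simp
  qed auto
  then obtain r where r: "strict_mono r" "AE x in lebesgue. (\<lambda>n. indicat_real (G (r n)) x) \<longlonglongrightarrow> 0"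
    using tendsto_L1_AE_subseq[of lebesgue "\<lambda>n. indicat_real (G n)"] int by auto
  have "(\<lambda>n. LINT x|lebesgue. M x * indicat_real (G (r n)) x) \<longlonglongrightarrow> (LINT x::real|lebesgue. 0)"
  proof (rule integral_dominated_convergence[where w = M])
    show "AE x in lebesgue. (\<lambda>n. M x * indicat_real (G (r n)) x) \<longlonglongrightarrow> 0"
      using r(2)
    proof eventually_elim
      case (elim x)
      show ?case using tendsto_mult_left[OF elim, of "M x"] by simp
    qed
    show "AE x in lebesgue. norm (M x * indicat_real (G (r n)) x) \<le> M x" for n
      by (auto simp: indicator_def M0)
  qed (use M Gs in auto)
  then have "\<forall>\<^sub>F n in sequentially. (LINT x|lebesgue. M x * indicat_real (G (r n)) x) < \<epsilon>"
    using \<epsilon> by (intro order_tendstoD) auto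
  then obtain n where n: "(LINT x|lebesgue. M x * indicat_real (G (r n)) x) < \<epsilon>"
    by (auto simp: eventually_sequentially)
  define F where "F x = M x * indicat_real (G (r n)) x" for x
  have F: "integrable lebesgue F" unfolding F_def
    by (rule integrable_real_mult_indicator[OF Gs M])
  have F0: "F x \<ge> 0" for x by (simp add: F_def M0)
  define H where "H t = (LINT x|lebesgue. indicat_real {..t} x * F x)" for t
  have Fi: "integrable lebesgue (\<lambda>x. indicat_real A x * F x)" if "A \<in> sets lebesgue" for A
    using integrable_mult_indicator[OF that F] by simp
  have Hinc: "(LINT x|lebesgue. indicat_real {s..t} x * F x) \<le> H t - H s" if "s \<le> t" for s t
  proof -
    have "(LINT x|lebesgue. indicat_real {s..t} x * F x) + H s
      = (LINT x|lebesgue. indicat_real {s..t} x * F x + indicat_real {..s} x * F x)"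
      unfolding H_def by (intro Bochner_Integration.integral_add[symmetric] Fi) auto
    also have "\<dots> \<le> H t" unfolding H_def
    proof (intro integral_mono_AE Bochner_Integration.integrable_add Fi)
      have "AE x in lebesgue. x \<noteq> s"
        by (rule AE_I'[of "{s}"]) (auto simp: negligible_iff_null_sets[symmetric])
      then show "AE x in lebesgue. indicat_real {s..t} x * F x + indicat_real {..s} x * F x \<le> indicat_real {..t} x * F x"
        by eventually_elim (use F0 that in \<open>auto simp: indicator_def\<close>)
    qed auto
    finally show ?thesis by simp
  qed
  have Hmono: "H s \<le> H t" if "s \<le> t" for s t
  proof -
    have "0 \<le> (LINT x|lebesgue. indicat_real {s..t} x * F x)"
      by (intro Bochner_Integration.integral_nonneg) (auto simp: F0)
    with Hinc[OF that] show ?thesis by simp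
  qed
  have Hb: "H b - H a \<le> \<epsilon>"
  proof -
    have "H b \<le> (LINT x|lebesgue. F x)" unfolding H_def
      by (intro integral_mono Fi F) (auto simp: indicator_def F0)
    moreover have "0 \<le> H a" unfolding H_def by (intro Bochner_Integration.integral_nonneg) (auto simp: F0)
    ultimately show ?thesis using n by (simp add: F_def)
  qed
  \<comment> \<open>\<open>P\<close> is additive under concatenation of intervals, so
    \<open>Bolzano\<close> reduces it to short intervals around each point. Near a point of
    \<open>N'\<close> they lie in the small open set, and the increase of \<open>H\<close> pays for
    the increment; elsewhere the derivative pays, with slope error
    \<open>\<epsilon>\<close>.\<close>
  define P where "P s t \<longleftrightarrow> (a \<le> s \<and> s \<le> t \<and> t \<le> b \<longrightarrow> \<phi> t - \<phi> s \<le> (C + \<epsilon>) * (t - s) + (H t - H s))" for s t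
  have "a \<le> a \<and> b \<le> b \<longrightarrow> P a b"
  proof (rule impI, rule Bolzano[OF ab])
    fix s u t assume "P s u" "P u t" "s \<le> u" "u \<le> t"
    then show "P s t" unfolding P_def by (auto simp: algebra_simps)
  next
    fix x assume x: "a \<le> x" "x \<le> b"
    show "\<exists>d>0. \<forall>s t. s \<le> x \<and> x \<le> t \<and> t - s < d \<longrightarrow> P s t"
    proof (cases "x \<in> N'")
      case True
      then obtain d where d: "d > 0" "ball x d \<subseteq> G (r n)"
        using G(1,2) by (meson open_contains_ball subsetD)
      have "P s t" if st: "s \<le> x" "x \<le> t" "t - s < d" for s t
        unfolding P_def
      proof (intro impI)
        assume *: "a \<le> s \<and> s \<le> t \<and> t \<le> b"
        have sub: "{s..t} \<subseteq> G (r n)"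
          using st by (intro order_trans[OF _ d(2)]) (auto simp: dist_real_def)
        have i1: "integrable lebesgue (\<lambda>y. indicat_real {s..t} y * m y)"
          using set_integrable_subset[OF m, of "{s..t}"] * by (simp add: set_integrable_def)
        have i2: "integrable lebesgue (\<lambda>y. C * indicat_real {s..t} y)"
          by (auto simp: integrable_indicator_iff emeasure_lborel_Icc_eq)
        have "\<phi> t - \<phi> s - C * (t - s) \<le> K * set_lebesgue_integral lebesgue {s..t} m - C * (t - s)"
          using incr[of s t] * by auto
        also have "\<dots> = (LINT y|lebesgue. K * (indicat_real {s..t} y * m y) - C * indicat_real {s..t} y)"
          using i1 i2 * by (simp add: set_lebesgue_integral_def)
        also have "\<dots> \<le> (LINT y|lebesgue. indicat_real {s..t} y * F y)"
        proof (intro integral_mono Fi)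
          fix y
          show "K * (indicat_real {s..t} y * m y) - C * indicat_real {s..t} y \<le> indicat_real {s..t} y * F y"
            using sub * abs_ge_self[of "K * m y"] by (auto simp: indicator_def F_def M_def subset_iff)
        qed (use i1 i2 in auto)
        also have "\<dots> \<le> H t - H s" using Hinc * by auto
        finally show "\<phi> t - \<phi> s \<le> (C + \<epsilon>) * (t - s) + (H t - H s)"
          using \<epsilon> * by (simp add: algebra_simps) (smt (verit) mult_left_mono)
      qed
      with d show ?thesis by auto
    next
      case False
      then have "a < x" "x < b" "x \<notin> N" using x by (auto simp: N'_def)
      then obtain D where D: "D \<le> C" "(\<phi> has_real_derivative D) (at x)"
        using Nsub by auto
      then have "(\<phi> has_derivative (\<lambda>h. h * D)) (at x)"
        by (simp add: has_field_derivative_def mult.commute[of _ D])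
      then obtain d where d: "d > 0"
        "\<And>y. \<bar>y - x\<bar> < d \<Longrightarrow> \<bar>\<phi> y - \<phi> x - (y - x) * D\<bar> \<le> \<epsilon> * \<bar>y - x\<bar>"
        using \<epsilon>(1) unfolding has_derivative_at_alt by (auto simp: real_norm_def)
      have "P s t" if st: "s \<le> x" "x \<le> t" "t - s < d" for s t
      proof -
        have "\<bar>\<phi> t - \<phi> x - (t - x) * D\<bar> \<le> \<epsilon> * (t - x)" "\<bar>\<phi> s - \<phi> x - (s - x) * D\<bar> \<le> \<epsilon> * (x - s)"
          using d(2)[of t] d(2)[of s] st by auto
        then have "\<phi> t - \<phi> s \<le> (D + \<epsilon>) * (t - s)" by (simp add: algebra_simps)
        also have "\<dots> \<le> (C + \<epsilon>) * (t - s)" using D st by (intro mult_right_mono) auto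
        finally show ?thesis unfolding P_def using Hmono[of s t] by auto
      qed
      with d show ?thesis by auto
    qed
  qed
  then have "\<phi> b - \<phi> a \<le> (C + \<epsilon>) * (b - a) + \<epsilon>"
    using Hb ab unfolding P_def by auto
  then show "\<phi> b - \<phi> a \<le> C * (b - a) + \<epsilon>0" using \<epsilon>(2) by (simp add: algebra_simps)
qed

section \<open>The space \<open>L\<^sup>2\<close> and weak limits of bounded sequences\<close>

lemma L2_mult_integrable:
  assumes "f \<in> L2 U" "g \<in> L2 U"
  shows "integrable (lebesgue_on U) (\<lambda>x. f x * g x)"
proof (rule Bochner_Integration.integrable_bound[of _ "\<lambda>x. (f x)\<^sup>2 + (g x)\<^sup>2"])
  have "\<bar>f x * g x\<bar> \<le> (f x)\<^sup>2 + (g x)\<^sup>2" for x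
    using sum_squares_bound[of "\<bar>f x\<bar>" "\<bar>g x\<bar>"] abs_ge_zero[of "f x * g x"]
    by (simp add: abs_mult[symmetric] mult.assoc)
  then show "AE x in lebesgue_on U. norm (f x * g x) \<le> norm ((f x)\<^sup>2 + (g x)\<^sup>2)" by auto
qed (use assms in \<open>auto simp: L2_def\<close>)

lemma L2_add:
  assumes "f \<in> L2 U" "g \<in> L2 U"
  shows "(\<lambda>x. f x + g x) \<in> L2 U"
proof -
  have "integrable (lebesgue_on U) (\<lambda>x. (f x)\<^sup>2 + (g x)\<^sup>2 + 2 * (f x * g x))"
    using assms L2_mult_integrable[OF assms] by (auto simp: L2_def)
  then show ?thesis using assms by (auto simp: L2_def power2_sum mult.assoc)
qed

lemma L2_cmult: "f \<in> L2 U \<Longrightarrow> (\<lambda>x. c * f x) \<in> L2 U"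
  by (auto simp: L2_def power_mult_distrib)

lemma L2_diff:
  assumes "f \<in> L2 U" "g \<in> L2 U"
  shows "(\<lambda>x. f x - g x) \<in> L2 U"
  using L2_add[OF assms(1) L2_cmult[OF assms(2), of "-1"]] by simp

lemma L2_norm_nonneg: "L2_norm U f \<ge> 0"
  by (simp add: L2_norm_def)

lemma L2_norm_sq: "(L2_norm U f)\<^sup>2 = L2_inner U f f"
  by (simp add: L2_norm_def L2_inner_def power2_eq_square)

lemma L2_inner_commute: "L2_inner U f g = L2_inner U g f"
  by (simp add: L2_inner_def mult.commute)

lemma L2_inner_diff_left:
  assumes "f \<in> L2 U" "g \<in> L2 U" "h \<in> L2 U"
  shows "L2_inner U (\<lambda>x. f x - g x) h = L2_inner U f h - L2_inner U g h"
  using assms by (simp add: L2_inner_def left_diff_distrib L2_mult_integrable)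

lemma L2_inner_diff_right:
  assumes "f \<in> L2 U" "g \<in> L2 U" "h \<in> L2 U"
  shows "L2_inner U h (\<lambda>x. f x - g x) = L2_inner U h f - L2_inner U h g"
  using L2_inner_diff_left[OF assms] by (simp add: L2_inner_commute)

lemma L2_inner_cmult_left: "L2_inner U (\<lambda>x. c * f x) h = c * L2_inner U f h"
  by (simp add: L2_inner_def mult.assoc)

lemma L2_norm_diff_sq:
  assumes "f \<in> L2 U" "g \<in> L2 U"
  shows "(L2_norm U (\<lambda>x. f x - g x))\<^sup>2 = (L2_norm U f)\<^sup>2 - 2 * L2_inner U f g + (L2_norm U g)\<^sup>2"
  using assms by (simp add: L2_norm_sq L2_inner_diff_left L2_inner_diff_right L2_diff L2_inner_commute[of U g f])

lemma L2_norm_eq_0_iff: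
  assumes "f \<in> L2 U"
  shows "L2_norm U f = 0 \<longleftrightarrow> (AE x in lebesgue_on U. f x = 0)"
  using assms integral_nonneg_eq_0_iff_AE[of "lebesgue_on U" "\<lambda>x. (f x)\<^sup>2"]
  by (simp add: L2_norm_def L2_def)

lemma L2_Cauchy_Schwarz:
  assumes "f \<in> L2 U" "g \<in> L2 U"
  shows "\<bar>L2_inner U f g\<bar> \<le> L2_norm U f * L2_norm U g"
proof (cases "L2_norm U g = 0")
  case True
  then have "AE x in lebesgue_on U. g x = 0" using L2_norm_eq_0_iff assms by blast
  then have "L2_inner U f g = (LINT x|lebesgue_on U. 0)" unfolding L2_inner_def
    using assms by (intro integral_cong_AE) (auto simp: L2_def)
  with True show ?thesis by simp
next
  case False
  define A and B and C where "A = L2_norm U f" and "B = L2_inner U f g" and "C = L2_norm U g"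
  define k where "k = B / C\<^sup>2"
  have kg: "L2_inner U f (\<lambda>x. k * g x) = k * B" "(L2_norm U (\<lambda>x. k * g x))\<^sup>2 = k\<^sup>2 * C\<^sup>2"
    by (simp_all add: B_def C_def L2_norm_def L2_inner_def power_mult_distrib mult.left_commute)
  have "0 \<le> (L2_norm U (\<lambda>x. f x - k * g x))\<^sup>2" by simp
  also have "\<dots> = A\<^sup>2 - 2 * (B / C\<^sup>2) * B + (B / C\<^sup>2)\<^sup>2 * C\<^sup>2"
    using L2_norm_diff_sq[OF assms(1) L2_cmult[OF assms(2)], of k]
    by (simp add: kg) (simp add: A_def k_def)
  also have "\<dots> = A\<^sup>2 - B\<^sup>2 / C\<^sup>2" using False by (simp add: C_def power2_eq_square field_simps)
  finally have "B\<^sup>2 \<le> (A * C)\<^sup>2" using False by (simp add: C_def field_simps power_mult_distrib)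
  then show ?thesis unfolding A_def B_def C_def
    by (metis L2_norm_nonneg abs_le_square_iff abs_of_nonneg mult_nonneg_nonneg)
qed

lemma L2_bounded:
  assumes "bounded U" "U \<in> sets lebesgue" "f \<in> borel_measurable (lebesgue_on U)"
    and "AE x in lebesgue_on U. \<bar>f x\<bar> \<le> B"
  shows "f \<in> L2 U"
proof -
  have "finite_measure (lebesgue_on U)"
    using assms by (intro finite_measure_lebesgue_on bounded_set_imp_lmeasurable)
  moreover have "AE x in lebesgue_on U. norm ((f x)\<^sup>2) \<le> B\<^sup>2"
    using assms(4) by eventually_elim (simp add: abs_le_square_iff[symmetric])
  ultimately show ?thesis using assms(3)
    by (auto simp: L2_def intro!: finite_measure.integrable_const_bound[of _ _ "B\<^sup>2"])
qed

text \<open>Mazur's argument: elements of almost minimal \<open>L\<^sup>2\<close> norm in decreasing midpoint convex sets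
  form a Cauchy sequence by the parallelogram identity. Here the sets consist of the functions that
  satisfy every linear bound satisfied by the tail \<open>(D m)\<^sub>m\<^sub>\<ge>\<^sub>n\<close>.\<close>

lemma bounded_sequence_weak_limit:
  fixes D :: "nat \<Rightarrow> 'a \<Rightarrow> real" and T :: "('a \<Rightarrow> real) set" and \<l> :: "('a \<Rightarrow> real) \<Rightarrow> real"
  assumes fin: "finite_measure M"
    and D: "\<And>m. D m \<in> borel_measurable M" "\<And>m x. \<bar>D m x\<bar> \<le> L"
    and T: "\<And>\<phi>. \<phi> \<in> T \<Longrightarrow> integrable M \<phi>"
    and lim: "\<And>\<phi>. \<phi> \<in> T \<Longrightarrow> (\<lambda>m. LINT x|M. D m x * \<phi> x) \<longlonglongrightarrow> \<l> \<phi>"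
  obtains G where "G \<in> borel_measurable M" "\<And>x. \<bar>G x\<bar> \<le> L"
    "\<And>\<phi>. \<phi> \<in> T \<Longrightarrow> (LINT x|M. G x * \<phi> x) = \<l> \<phi>"
proof -
  interpret finite_measure M by fact
  define K where "K n = {v \<in> borel_measurable M. (\<forall>x. \<bar>v x\<bar> \<le> L) \<and>
     (\<forall>\<phi>\<in>T. \<forall>c d. (\<forall>m\<ge>n. c \<le> (LINT x|M. D m x * \<phi> x) \<and> (LINT x|M. D m x * \<phi> x) \<le> d)
        \<longrightarrow> c \<le> (LINT x|M. v x * \<phi> x) \<and> (LINT x|M. v x * \<phi> x) \<le> d)}" for n :: nat
  have L0: "L \<ge> 0" using D(2)[of 0 undefined] by linarith
  have DK: "D n \<in> K n" for n unfolding K_def using D by auto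
  have K_anti: "K m \<subseteq> K n" if "n \<le> m" for n m unfolding K_def using that order_trans by blast
  have Kmeas: "v \<in> borel_measurable M" and Kbd: "\<bar>v x\<bar> \<le> L" if "v \<in> K n" for v n x
    using that by (auto simp: K_def)
  have sqint: "integrable M (\<lambda>x. (v x)\<^sup>2)" if "v \<in> borel_measurable M" "\<And>x. \<bar>v x\<bar> \<le> B" for v and B :: real
  proof (rule integrable_const_bound[where B="B\<^sup>2"])
    have "(v x)\<^sup>2 \<le> B\<^sup>2" for x using that(2)[of x] by (simp add: abs_le_square_iff[symmetric])
    then show "AE x in M. norm ((v x)\<^sup>2) \<le> B\<^sup>2" by auto
  qed (use that in auto)
  have pint: "integrable M (\<lambda>x. v x * \<phi> x)" if "v \<in> borel_measurable M" "\<And>x. \<bar>v x\<bar> \<le> L" "\<phi> \<in> T" for v \<phi>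
  proof (rule Bochner_Integration.integrable_bound[of _ "\<lambda>x. L * \<phi> x"])
    show "AE x in M. norm (v x * \<phi> x) \<le> norm (L * \<phi> x)"
      using that(2) L0 by (auto simp: abs_mult intro!: mult_right_mono)
  qed (use that T[of \<phi>] in auto)
  have mid: "(\<lambda>x. (v x + w x) / 2) \<in> K n" if v: "v \<in> K n" and w: "w \<in> K n" for v w n
    unfolding K_def
  proof (intro CollectI conjI ballI allI impI)
    show "(\<lambda>x. (v x + w x) / 2) \<in> borel_measurable M" using Kmeas[OF v] Kmeas[OF w] by simp
    show "\<bar>(v x + w x) / 2\<bar> \<le> L" for x using Kbd[OF v, of x] Kbd[OF w, of x] by simp
    fix \<phi> c d assume \<phi>: "\<phi> \<in> T"
      and *: "\<forall>m\<ge>n. c \<le> (LINT x|M. D m x * \<phi> x) \<and> (LINT x|M. D m x * \<phi> x) \<le> d"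
    have "(LINT x|M. (v x + w x) / 2 * \<phi> x) = (LINT x|M. (v x * \<phi> x + w x * \<phi> x) / 2)"
      by (simp add: algebra_simps add_divide_distrib)
    also have "\<dots> = ((LINT x|M. v x * \<phi> x) + (LINT x|M. w x * \<phi> x)) / 2"
      using pint[OF Kmeas[OF v] Kbd[OF v] \<phi>] pint[OF Kmeas[OF w] Kbd[OF w] \<phi>] by simp
    finally have eq: "(LINT x|M. (v x + w x) / 2 * \<phi> x) = \<dots>" .
    have "c \<le> (LINT x|M. v x * \<phi> x) \<and> (LINT x|M. v x * \<phi> x) \<le> d"
      "c \<le> (LINT x|M. w x * \<phi> x) \<and> (LINT x|M. w x * \<phi> x) \<le> d"
      using v w \<phi> * unfolding K_def by blast+
    then show "c \<le> (LINT x|M. (v x + w x) / 2 * \<phi> x)" "(LINT x|M. (v x + w x) / 2 * \<phi> x) \<le> d"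
      unfolding eq by auto
  qed
  define q where "q v = (LINT x|M. (v x)\<^sup>2)" for v :: "'a \<Rightarrow> real"
  have q0: "q v \<ge> 0" for v unfolding q_def by simp
  define \<alpha> where "\<alpha> n = Inf (q ` K n)" for n
  have bdd: "bdd_below (q ` K n)" for n using q0 by (intro bdd_belowI2[of _ 0]) auto
  have \<alpha>_le: "\<alpha> n \<le> q v" if "v \<in> K n" for n v unfolding \<alpha>_def using that bdd by (simp add: cInf_lower)
  have "incseq \<alpha>" unfolding incseq_def \<alpha>_def
    using bdd K_anti DK by (intro allI impI cInf_superset_mono image_mono) (blast, simp_all)
  moreover have "\<alpha> n \<le> L\<^sup>2 * measure M (space M)" for n
  proof -
    have "\<alpha> n \<le> q (D n)" using \<alpha>_le DK by simp
    also have "\<dots> \<le> (LINT x|M. L\<^sup>2)" unfolding q_def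
    proof (rule integral_mono)
      show "(D n x)\<^sup>2 \<le> L\<^sup>2" for x using D(2)[of n x] by (simp add: abs_le_square_iff[symmetric])
    qed (use sqint[OF D] in auto)
    finally show ?thesis by (simp add: mult.commute)
  qed
  ultimately obtain \<alpha>' where \<alpha>': "\<alpha> \<longlonglongrightarrow> \<alpha>'" "\<And>n. \<alpha> n \<le> \<alpha>'"
    using incseq_convergent[of \<alpha>] by metis
  have "\<exists>v\<in>K n. q v \<le> \<alpha> n + 1 / Suc n" for n
  proof -
    have "Inf (q ` K n) < \<alpha> n + 1 / Suc n" unfolding \<alpha>_def by simp
    then obtain y where "y \<in> q ` K n" "y < \<alpha> n + 1 / Suc n"
      using cInf_lessD[of "q ` K n"] DK[of n] by blast
    then show ?thesis by force
  qed
  then obtain v where v: "\<And>n. v n \<in> K n" "\<And>n. q (v n) \<le> \<alpha> n + 1 / Suc n" by metis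
  have vm[measurable]: "v n \<in> borel_measurable M" and vb: "\<bar>v n x\<bar> \<le> L" for n x
    using Kmeas Kbd v(1) by blast+
  have vint: "integrable M (v n)" for n
    by (rule integrable_const_bound[where B=L]) (use vb in auto)
  have dist: "q (\<lambda>x. v i x - v j x) \<le> 4 * (\<alpha>' - \<alpha> N + 1 / Suc N)" if "i \<ge> N" "j \<ge> N" for i j N
  proof -
    have Kij: "v i \<in> K N" "v j \<in> K N" using v(1) K_anti that by blast+
    have s: "integrable M (\<lambda>x. (v i x)\<^sup>2)" "integrable M (\<lambda>x. (v j x)\<^sup>2)"
       "integrable M (\<lambda>x. ((v i x + v j x) / 2)\<^sup>2)"
      using sqint[OF vm vb] sqint[OF Kmeas[OF mid[OF Kij]] Kbd[OF mid[OF Kij]]] by auto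
    have "(v i x - v j x)\<^sup>2 = 2 * (v i x)\<^sup>2 + 2 * (v j x)\<^sup>2 - 4 * ((v i x + v j x) / 2)\<^sup>2" for x
      by (simp add: power2_eq_square field_simps)
    then have "q (\<lambda>x. v i x - v j x) = 2 * q (v i) + 2 * q (v j) - 4 * q (\<lambda>x. (v i x + v j x) / 2)"
      unfolding q_def using s by simp
    moreover have "q (\<lambda>x. (v i x + v j x) / 2) \<ge> \<alpha> N" using \<alpha>_le mid[OF Kij] by blast
    moreover have "q (v k) \<le> \<alpha>' + 1 / Suc N" if "k \<ge> N" for k
    proof -
      have "1 / real (Suc k) \<le> 1 / real (Suc N)" using that by (intro divide_left_mono) auto
      then show ?thesis using v(2)[of k] \<alpha>'(2)[of k] by linarith
    qed
    ultimately show ?thesis using that by (smt (verit))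
  qed
  have cauchy: "\<exists>N. \<forall>i\<ge>N. \<forall>j\<ge>N. (LINT x|M. norm (v i x - v j x)) < e" if "e > 0" for e :: real
  proof -
    define V where "V = measure M (space M) + 1"
    have V: "V > 0" "measure M (space M) \<le> V" by (auto simp: V_def add_nonneg_pos)
    \<comment> \<open>The inequality \<open>\<bar>z\<bar> \<le> \<eta> + z\<^sup>2 / \<eta>\<close>
      turns smallness of the squared distance into smallness in the mean, from which an almost
      everywhere convergent subsequence is drawn. This \<open>\<eta>\<close> makes the first term
      contribute at most \<open>e / 2\<close>.\<close>
    define \<eta> where "\<eta> = e / (2 * V)"
    have \<eta>: "\<eta> > 0" using V that by (simp add: \<eta>_def)
    have "(\<lambda>N. 4 * (\<alpha>' - \<alpha> N + 1 / Suc N)) \<longlonglongrightarrow> 4 * (\<alpha>' - \<alpha>' + 0)"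
      by (intro tendsto_intros \<alpha>' LIMSEQ_Suc[OF lim_1_over_n])
    then have "\<forall>\<^sub>F N in sequentially. 4 * (\<alpha>' - \<alpha> N + 1 / Suc N) < \<eta> * (e / 2)"
      using \<eta> that by (intro order_tendstoD) auto
    then obtain N where N: "4 * (\<alpha>' - \<alpha> N + 1 / Suc N) < \<eta> * (e / 2)"
      by (auto simp: eventually_sequentially)
    have "(LINT x|M. norm (v i x - v j x)) < e" if "i \<ge> N" "j \<ge> N" for i j
    proof -
      have s: "integrable M (\<lambda>x. (v i x - v j x)\<^sup>2)"
      proof (rule sqint)
        show "\<bar>v i x - v j x\<bar> \<le> 2 * L" for x using vb[of i x] vb[of j x] by linarith
      qed measurable
      have "(LINT x|M. norm (v i x - v j x)) \<le> (LINT x|M. \<eta> + (v i x - v j x)\<^sup>2 / \<eta>)"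
      proof (intro integral_mono)
        fix x
        have "2 * \<bar>v i x - v j x\<bar> * \<eta> \<le> (v i x - v j x)\<^sup>2 + \<eta>\<^sup>2"
          using sum_squares_bound[of "\<bar>v i x - v j x\<bar>" \<eta>] by simp
        then have "\<bar>v i x - v j x\<bar> * \<eta> \<le> \<eta> * \<eta> + (v i x - v j x)\<^sup>2"
          using mult_nonneg_nonneg[OF abs_ge_zero[of "v i x - v j x"] less_imp_le[OF \<eta>]]
          unfolding power2_eq_square by linarith
        then show "norm (v i x - v j x) \<le> \<eta> + (v i x - v j x)\<^sup>2 / \<eta>"
          using \<eta> by (simp add: field_simps)
      qed (use vint s in auto)
      also have "\<dots> = \<eta> * measure M (space M) + q (\<lambda>x. v i x - v j x) / \<eta>"
        using s by (simp add: q_def)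
      also have "\<dots> < e / 2 + e / 2"
      proof (rule add_le_less_mono)
        have "\<eta> * measure M (space M) \<le> \<eta> * V" using V \<eta> by simp
        then show "\<eta> * measure M (space M) \<le> e / 2" using V by (simp add: \<eta>_def)
        show "q (\<lambda>x. v i x - v j x) / \<eta> < e / 2"
          using le_less_trans[OF dist[OF that] N] \<eta> by (simp only: pos_divide_less_eq mult.commute)
      qed
      finally show ?thesis by simp
    qed
    then show ?thesis by blast
  qed
  obtain r where r: "strict_mono r" "AE x in M. Cauchy (\<lambda>i. v (r i) x)"
    using cauchy_L1_AE_cauchy_subseq[of M v] vint cauchy by auto
  \<comment> \<open>The value 0 off the set of convergence keeps \<open>G\<close> measurable and
    bounded by \<open>L\<close> at every point, not only almost everywhere.\<close>
  define G where "G x = (if Cauchy (\<lambda>i. v (r i) x) then lim (\<lambda>i. v (r i) x) else 0)" for x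
  have Glim: "AE x in M. (\<lambda>i. v (r i) x) \<longlonglongrightarrow> G x"
    using r(2) by eventually_elim (auto simp: G_def Cauchy_convergent_iff convergent_LIMSEQ_iff)
  have Gm: "G \<in> borel_measurable M" unfolding G_def by measurable
  have Gb: "\<bar>G x\<bar> \<le> L" for x
  proof (cases "Cauchy (\<lambda>i. v (r i) x)")
    case True
    then have "(\<lambda>i. v (r i) x) \<longlonglongrightarrow> G x" by (auto simp: G_def Cauchy_convergent_iff convergent_LIMSEQ_iff)
    then have "(\<lambda>i. \<bar>v (r i) x\<bar>) \<longlonglongrightarrow> \<bar>G x\<bar>" by (rule tendsto_rabs)
    then show ?thesis by (rule LIMSEQ_le_const2) (use vb in auto)
  qed (simp add: G_def L0)
  show ?thesis
  proof (rule that[OF Gm Gb])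
    fix \<phi> assume \<phi>: "\<phi> \<in> T"
    have \<phi>i: "integrable M \<phi>" by (rule T[OF \<phi>])
    have 1: "(\<lambda>i. LINT x|M. v (r i) x * \<phi> x) \<longlonglongrightarrow> (LINT x|M. G x * \<phi> x)"
    proof (rule integral_dominated_convergence[where w="\<lambda>x. L * \<bar>\<phi> x\<bar>"])
      show "AE x in M. (\<lambda>i. v (r i) x * \<phi> x) \<longlonglongrightarrow> G x * \<phi> x"
        using Glim by eventually_elim (intro tendsto_intros)
      show "AE x in M. norm (v (r i) x * \<phi> x) \<le> L * \<bar>\<phi> x\<bar>" for i
        using vb by (auto simp: abs_mult intro!: mult_right_mono)
    qed (use \<phi>i Gm in auto)
    have "(\<lambda>n. LINT x|M. v n x * \<phi> x) \<longlonglongrightarrow> \<l> \<phi>"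
    proof (rule LIMSEQ_I)
      fix e :: real assume e: "e > 0"
      then obtain N where N: "\<And>m. m \<ge> N \<Longrightarrow> \<bar>(LINT x|M. D m x * \<phi> x) - \<l> \<phi>\<bar> < e / 2"
        using LIMSEQ_D[OF lim[OF \<phi>], of "e/2"] by auto
      have "norm ((LINT x|M. v n x * \<phi> x) - \<l> \<phi>) < e" if "n \<ge> N" for n
      proof -
        \<comment> \<open>Membership in \<open>K n\<close> carries the interval of radius
          \<open>e / 2\<close> around \<open>\<l> \<phi>\<close> over from the tail of
          \<open>D\<close> to \<open>v n\<close>.\<close>
        have "\<forall>m\<ge>n. \<l> \<phi> - e / 2 \<le> (LINT x|M. D m x * \<phi> x) \<and> (LINT x|M. D m x * \<phi> x) \<le> \<l> \<phi> + e / 2"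
          using N that by (smt (verit) order_trans)
        then have "\<l> \<phi> - e / 2 \<le> (LINT x|M. v n x * \<phi> x) \<and> (LINT x|M. v n x * \<phi> x) \<le> \<l> \<phi> + e / 2"
          using v(1)[of n] \<phi> unfolding K_def by blast
        then show ?thesis using e by auto
      qed
      then show "\<exists>no. \<forall>n\<ge>no. norm ((LINT x|M. v n x * \<phi> x) - \<l> \<phi>) < e" by blast
    qed
    then have "(\<lambda>i. LINT x|M. v (r i) x * \<phi> x) \<longlonglongrightarrow> \<l> \<phi>"
      using LIMSEQ_subseq_LIMSEQ[OF _ r(1)] by (auto simp: o_def)
    then show "(LINT x|M. G x * \<phi> x) = \<l> \<phi>" using 1 LIMSEQ_unique by blast
  qed
qed

section \<open>Test functions\<close>

lemma C1cI:
  fixes \<phi> :: "'a::euclidean_space \<Rightarrow> 'b::euclidean_space"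
  assumes d: "\<And>x. (\<phi> has_derivative \<phi>' x) (at x)"
    and c: "\<And>h. continuous_on UNIV (\<lambda>x. \<phi>' x h)"
    and K: "compact K" "K \<subseteq> U" "\<And>x. x \<notin> K \<Longrightarrow> \<phi> x = 0"
  shows "\<phi> \<in> C1c U"
proof -
  have fd: "frechet_derivative \<phi> (at x) = \<phi>' x" for x
    by (rule frechet_derivative_at[OF d, symmetric])
  have sub: "closure {x. \<phi> x \<noteq> 0} \<subseteq> K"
    using K by (intro closure_minimal compact_imp_closed) auto
  have "compact (closure {x. \<phi> x \<noteq> 0})"
    using bounded_subset[OF compact_imp_bounded[OF K(1)] sub] by (simp add: compact_eq_bounded_closed)
  moreover have "\<phi> differentiable (at x)" for x using d by (rule differentiableI)
  moreover have "closure {x. \<phi> x \<noteq> 0} \<subseteq> U" using sub K(2) by (rule order_trans)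
  ultimately show ?thesis using c by (simp add: C1c_def fd)
qed

lemma C1c_support:
  assumes "\<phi> \<in> C1c U"
  obtains K where "compact K" "K \<subseteq> U" "\<And>x. x \<notin> K \<Longrightarrow> \<phi> x = 0"
    "\<And>x. x \<notin> K \<Longrightarrow> frechet_derivative \<phi> (at x) = (\<lambda>h. 0)"
proof
  let ?K = "closure {x. \<phi> x \<noteq> 0}"
  show "compact ?K" "?K \<subseteq> U" using assms by (auto simp: C1c_def)
  show 1: "\<phi> x = 0" if "x \<notin> ?K" for x using that closure_subset[of "{x. \<phi> x \<noteq> 0}"] by blast
  show "frechet_derivative \<phi> (at x) = (\<lambda>h. 0)" if "x \<notin> ?K" for x
  proof -
    have "(\<phi> has_derivative (\<lambda>h. 0)) (at x)"
    proof (rule has_derivative_transform_within_open[where s = "- ?K"])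
      show "((\<lambda>y. 0) has_derivative (\<lambda>h. 0)) (at x)" by (rule has_derivative_const)
      show "open (- ?K)" by (simp add: open_Compl)
      show "x \<in> - ?K" using that by simp
      show "0 = \<phi> y" if "y \<in> - ?K" for y using 1[of y] that by simp
    qed
    then show ?thesis by (rule frechet_derivative_at[symmetric])
  qed
qed

lemma C1c_has_derivative:
  "\<phi> \<in> C1c U \<Longrightarrow> (\<phi> has_derivative frechet_derivative \<phi> (at x)) (at x)"
  by (rule iffD1[OF frechet_derivative_works]) (simp add: C1c_def)

lemma C1c_continuous: "\<phi> \<in> C1c U \<Longrightarrow> continuous_on UNIV \<phi>"
  by (intro continuous_at_imp_continuous_on ballI has_derivative_continuous[OF C1c_has_derivative])

text \<open>Squaring removes the kink of the positive part: at 0 the difference quotient is at most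
  \<open>\<bar>h\<bar>\<close>. This supplies the continuous differentiability of the bumps
  below.\<close>

lemma has_derivative_pos_part_square:
  "((\<lambda>t::real. (max 0 t)\<^sup>2) has_real_derivative 2 * max 0 t) (at t)"
proof (cases t "0::real" rule: linorder_cases)
  case less
  have "((\<lambda>t::real. 0) has_real_derivative 0) (at t)" by simp
  then show ?thesis using less
    by (subst DERIV_cong_ev[OF refl _ refl, of _ "\<lambda>_. 0"])
       (auto intro!: eventually_mono[OF order_tendstoD(2)[OF tendsto_ident_at less]] eventually_nhds_in_open
         simp: eventually_nhds intro!: exI[of _ "{..<0}"])
next
  case greater
  have "((\<lambda>t::real. t\<^sup>2) has_real_derivative 2 * t) (at t)"
    by (auto intro!: derivative_eq_intros)
  then show ?thesis using greater
    by (subst DERIV_cong_ev[OF refl _ refl, of _ "\<lambda>t. t\<^sup>2"])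
       (auto simp: eventually_nhds intro!: exI[of _ "{0<..}"])
next
  case equal
  have "(\<lambda>h::real. (max 0 h)\<^sup>2 / h) \<midarrow>0\<rightarrow> 0"
  proof (rule Lim_null_comparison[where g = "\<lambda>h. \<bar>h\<bar>"])
    show "\<forall>\<^sub>F h::real in at 0. norm ((max 0 h)\<^sup>2 / h) \<le> \<bar>h\<bar>"
      by (rule always_eventually) (auto simp: max_def power2_eq_square)
  qed (auto intro!: tendsto_eq_intros)
  then show ?thesis using equal by (simp add: DERIV_def)
qed

text \<open>With \<open>\<eta>\<close> the sum of the bumps \<open>((\<rho>\<^sup>2 - |x - c|\<^sup>2)\<^sub>+)\<^sup>2\<close>, the functions \<open>k \<eta> / (1 + k \<eta>)\<close>
  increase to the indicator function of the union of the balls.\<close>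

lemma C1c_approx_balls:
  fixes F :: "('a::euclidean_space \<times> real) set"
  assumes F: "finite F" "\<And>c \<rho>. (c, \<rho>) \<in> F \<Longrightarrow> \<rho> > 0 \<and> cball c \<rho> \<subseteq> U"
  obtains \<phi> :: "nat \<Rightarrow> 'a \<Rightarrow> real" where "\<And>k. \<phi> k \<in> C1c U" "\<And>k x. 0 \<le> \<phi> k x" "\<And>k x. \<phi> k x \<le> 1"
    "\<And>k x. x \<notin> (\<Union>(c, \<rho>)\<in>F. ball c \<rho>) \<Longrightarrow> \<phi> k x = 0"
    "\<And>x. (\<lambda>k. \<phi> k x) \<longlonglongrightarrow> indicator (\<Union>(c, \<rho>)\<in>F. ball c \<rho>) x"
proof -
  define b where "b p x = (max 0 ((snd p)\<^sup>2 - (x - fst p) \<bullet> (x - fst p)))\<^sup>2" for p :: "'a \<times> real" and x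
  define b' where "b' p x h = 2 * max 0 ((snd p)\<^sup>2 - (x - fst p) \<bullet> (x - fst p)) * (- 2 * ((x - fst p) \<bullet> h))"
    for p :: "'a \<times> real" and x h
  define \<eta> where "\<eta> x = (\<Sum>p\<in>F. b p x)" for x
  define \<eta>' where "\<eta>' x h = (\<Sum>p\<in>F. b' p x h)" for x h
  define \<phi> where "\<phi> k x = (real k * \<eta> x) / (1 + real k * \<eta> x)" for k x
  define \<phi>' where "\<phi>' k x h = real k * \<eta>' x h / (1 + real k * \<eta> x)\<^sup>2" for k x h
  have b: "(b p has_derivative b' p x) (at x)" for p x
  proof -
    have 1: "((\<lambda>x. (snd p)\<^sup>2 - (x - fst p) \<bullet> (x - fst p)) has_derivative (\<lambda>h. - 2 * ((x - fst p) \<bullet> h))) (at x)"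
      by (auto intro!: derivative_eq_intros simp: fun_eq_iff inner_commute)
    show ?thesis
      using has_derivative_compose[OF 1 has_derivative_pos_part_square[unfolded has_field_derivative_def]]
      unfolding b_def[abs_def] b'_def[abs_def] .
  qed
  have \<eta>: "(\<eta> has_derivative \<eta>' x) (at x)" for x
    unfolding \<eta>_def[abs_def] \<eta>'_def[abs_def] by (intro has_derivative_sum b)
  have \<eta>0: "\<eta> x \<ge> 0" for x unfolding \<eta>_def b_def by (intro sum_nonneg) auto
  have pos: "1 + real k * \<eta> x > 0" for k x using \<eta>0[of x] by (simp add: add_pos_nonneg)
  have \<phi>: "(\<phi> k has_derivative \<phi>' k x) (at x)" for k x
  proof -
    have "((\<lambda>y. y / (1 + y)) has_real_derivative 1 / (1 + y)\<^sup>2) (at y)" if "1 + y > 0" for y :: real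
      using that by (auto intro!: derivative_eq_intros simp: field_simps power2_eq_square)
    from has_derivative_compose[OF has_derivative_mult_right[OF \<eta>] this[OF pos[of k x], unfolded has_field_derivative_def]]
    show ?thesis unfolding \<phi>_def[abs_def] \<phi>'_def[abs_def] by simp
  qed
  have \<eta>c: "continuous_on UNIV \<eta>"
    by (intro continuous_at_imp_continuous_on ballI has_derivative_continuous[OF \<eta>])
  have \<phi>c: "continuous_on UNIV (\<lambda>x. \<phi>' k x h)" for k h
  proof -
    have "(1 + real k * \<eta> x)\<^sup>2 \<noteq> 0" for x using pos[of k x] by simp
    moreover have "continuous_on UNIV (\<lambda>x. \<eta>' x h)"
      unfolding \<eta>'_def b'_def by (intro continuous_intros)
    ultimately show ?thesis unfolding \<phi>'_def
      by (intro continuous_on_divide continuous_on_mult continuous_on_const continuous_on_power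
          continuous_on_add \<eta>c) auto
  qed
  have supp: "b p x > 0 \<longleftrightarrow> x \<in> ball (fst p) (snd p)" if "p \<in> F" for p x
  proof -
    have "snd p > 0" using F(2)[of "fst p" "snd p"] that by simp
    then have "(x - fst p) \<bullet> (x - fst p) < (snd p)\<^sup>2 \<longleftrightarrow> norm (x - fst p) < snd p"
      by (simp add: power2_norm_eq_inner[symmetric] abs_le_square_iff[symmetric] not_le[symmetric])
    then show ?thesis by (auto simp: b_def dist_norm norm_minus_commute max_def)
  qed
  have b0: "b p x \<ge> 0" for p x by (simp add: b_def)
  let ?W = "\<Union>(c, \<rho>)\<in>F. ball c \<rho>"
  have in0: "\<eta> x > 0" if x: "x \<in> ?W" for x
  proof -
    obtain c \<rho> where "(c, \<rho>) \<in> F" "x \<in> ball c \<rho>" using x by blast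
    then show ?thesis unfolding \<eta>_def using F(1) b0 supp[of "(c, \<rho>)"]
      by (intro sum_pos2[of F "(c, \<rho>)"]) auto
  qed
  have out0: "\<eta> x = 0" if "x \<notin> ?W" for x
    unfolding \<eta>_def
  proof (intro sum.neutral ballI)
    fix p assume "p \<in> F"
    then have "x \<notin> ball (fst p) (snd p)" using that by (cases p) auto
    then show "b p x = 0" using supp[OF \<open>p \<in> F\<close>] b0[of p x] by (meson not_le order_antisym)
  qed
  show thesis
  proof (rule that)
    show "\<phi> k \<in> C1c U" for k
    \<comment> \<open>The open balls carry the function; since \<open>F\<close> is finite, the
      closed balls form a compact set inside \<open>U\<close> that contains the support.\<close>
    proof (rule C1cI[OF \<phi> \<phi>c])
      show "compact (\<Union>(c, \<rho>)\<in>F. cball c \<rho>)" using F(1) by (intro compact_UN) auto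
      show "(\<Union>(c, \<rho>)\<in>F. cball c \<rho>) \<subseteq> U" using F by auto
      fix x assume "x \<notin> (\<Union>(c, \<rho>)\<in>F. cball c \<rho>)"
      then have "x \<notin> ?W" by fastforce
      then show "\<phi> k x = 0" using out0 by (simp add: \<phi>_def)
    qed
    show "0 \<le> \<phi> k x" for k x using pos \<eta>0 by (simp add: \<phi>_def less_imp_le)
    show "\<phi> k x \<le> 1" for k x using pos[of k x] by (simp add: \<phi>_def divide_le_eq)
    show "\<phi> k x = 0" if "x \<notin> ?W" for k x using out0[OF that] by (simp add: \<phi>_def)
    show "(\<lambda>k. \<phi> k x) \<longlonglongrightarrow> indicator ?W x" for x
    proof (cases "x \<in> ?W")
      case True
      define a where "a = \<eta> x"
      have "a > 0" using in0[OF True] by (simp add: a_def)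
      then have "filterlim (\<lambda>k. 1 + a * real k) at_top sequentially"
        by (intro filterlim_tendsto_add_at_top[OF tendsto_const]
            filterlim_tendsto_pos_mult_at_top[OF tendsto_const] filterlim_real_sequentially)
      then have "(\<lambda>k. 1 - inverse (1 + a * real k)) \<longlonglongrightarrow> 1 - 0"
        by (intro tendsto_diff tendsto_const tendsto_inverse_0_at_top)
      moreover have "1 - inverse (1 + a * real k) = \<phi> k x" for k
        using pos[of k x] by (simp add: \<phi>_def a_def field_simps)
      ultimately show ?thesis using True by simp
    next
      case False
      then show ?thesis using out0 by (simp add: \<phi>_def)
    qed
  qed
qed

section \<open>The fundamental lemma of the calculus of variations\<close>

lemma locally_integrable_measurable:
  fixes f :: "'a::euclidean_space \<Rightarrow> 'b::euclidean_space"
  assumes "open U" "locally_integrable U f"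
  shows "f \<in> borel_measurable (lebesgue_on U)"
proof -
  \<comment> \<open>Integrability is known on compact subsets only, so measurability on
    \<open>U\<close> is glued together from a countable family of compact sets.\<close>
  have "\<exists>C::nat \<Rightarrow> 'a set. (\<forall>n. compact (C n)) \<and> (\<forall>n. C n \<subseteq> U) \<and> (\<Union>n. C n) = U"
  proof (rule open_Union_compact_subsets[OF assms(1)])
    fix C :: "nat \<Rightarrow> 'a set"
    assume "\<And>n. compact (C n)" "\<And>n. C n \<subseteq> U" "(\<Union>n. C n) = U"
    then show ?thesis by (intro exI[of _ C]) simp
  qed
  then obtain C :: "nat \<Rightarrow> 'a set"
    where C': "(\<forall>n. compact (C n)) \<and> (\<forall>n. C n \<subseteq> U) \<and> (\<Union>n. C n) = U" ..
  then have C: "\<And>n. compact (C n)" "\<And>n. C n \<subseteq> U" "(\<Union>n. C n) = U" by simp_all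
  show ?thesis
  proof (rule measurable_piecewise_restrict[where C="range C"])
    fix \<Omega> assume "\<Omega> \<in> range C"
    then obtain n where n: "\<Omega> = C n" by auto
    have Cs: "C n \<in> sets lebesgue" using C(1) by (simp add: lmeasurable_compact fmeasurableD)
    then show "\<Omega> \<inter> space (lebesgue_on U) \<in> sets (lebesgue_on U)"
      using C(2) assms(1) n by (auto simp: sets_restrict_space_iff Int_absorb2)
    have "set_integrable lebesgue (C n) f" using assms(2) C by (auto simp: locally_integrable_def)
    then have "f \<in> borel_measurable (lebesgue_on (C n))"
      using Cs by (auto simp: set_integrable_def borel_measurable_restrict_space_iff)
    then show "f \<in> borel_measurable (restrict_space (lebesgue_on U) \<Omega>)"
      using C(2)[of n] assms(1) Cs n by (simp add: restrict_restrict_space Int_absorb1)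
  qed (use C in auto)
qed

lemma locally_integrable_mult_test_integrable:
  fixes h \<psi> :: "'a::euclidean_space \<Rightarrow> real"
  assumes U: "open U" and h: "locally_integrable U h"
    and K: "compact K" "K \<subseteq> U" and \<psi>: "\<psi> \<in> borel_measurable lebesgue"
      "\<And>x. x \<notin> K \<Longrightarrow> \<psi> x = 0" "\<And>x. \<bar>\<psi> x\<bar> \<le> B"
  shows "set_integrable lebesgue U (\<lambda>x. h x * \<psi> x)"
proof -
  have B: "B \<ge> 0" using \<psi>(3)[of undefined] by linarith
  have i: "integrable lebesgue (\<lambda>x. indicat_real K x * h x)"
    using h K by (simp add: locally_integrable_def set_integrable_def)
  have "integrable lebesgue (\<lambda>x. (indicat_real K x * h x) * \<psi> x)"
  proof (rule Bochner_Integration.integrable_bound[of _ "\<lambda>x. B * (indicat_real K x * h x)"])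
    show "AE x in lebesgue. norm (indicat_real K x * h x * \<psi> x) \<le> norm (B * (indicat_real K x * h x))"
      using \<psi>(3) B by (auto simp: abs_mult indicator_def mult.commute[of B] intro!: mult_left_mono)
  qed (use i \<psi> in auto)
  moreover have "(\<lambda>x. (indicat_real K x * h x) * \<psi> x) = (\<lambda>x. indicat_real U x *\<^sub>R (h x * \<psi> x))"
    using K(2) \<psi>(2) by (auto simp: fun_eq_iff indicator_def)
  ultimately show ?thesis by (simp add: set_integrable_def)
qed

lemma C1c_mult_integrable:
  fixes h \<phi> :: "'a::euclidean_space \<Rightarrow> real"
  assumes U: "open U" and h: "locally_integrable U h" and \<phi>: "\<phi> \<in> C1c U"
  shows "set_integrable lebesgue U (\<lambda>x. h x * \<phi> x)"
    and "set_integrable lebesgue U (\<lambda>x. h x * frechet_derivative \<phi> (at x) e)"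
proof -
  obtain K where K: "compact K" "K \<subseteq> U" "\<And>x. x \<notin> K \<Longrightarrow> \<phi> x = 0"
    "\<And>x. x \<notin> K \<Longrightarrow> frechet_derivative \<phi> (at x) = (\<lambda>h. 0)"
    using C1c_support[OF \<phi>] by metis
  have *: "set_integrable lebesgue U (\<lambda>x. h x * \<psi> x)"
    if c: "continuous_on UNIV \<psi>" and z: "\<And>x. x \<notin> K \<Longrightarrow> \<psi> x = 0" for \<psi> :: "'a \<Rightarrow> real"
  proof -
    obtain B where B: "\<And>x. x \<in> K \<Longrightarrow> \<bar>\<psi> x\<bar> \<le> B"
      using compact_imp_bounded[OF compact_continuous_image[OF continuous_on_subset[OF c] K(1)]]
      by (auto simp: bounded_iff)
    have "\<bar>\<psi> x\<bar> \<le> max B 0" for x using B[of x] z[of x] by (cases "x \<in> K") auto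
    moreover have "\<psi> \<in> borel_measurable lebesgue" 
      using borel_measurable_continuous_onI[OF c] by (simp add: measurable_completion)
    ultimately show ?thesis using z
      by (intro locally_integrable_mult_test_integrable[OF U h K(1,2), of \<psi> "max B 0"]) auto
  qed
  show "set_integrable lebesgue U (\<lambda>x. h x * \<phi> x)"
    using * C1c_continuous[OF \<phi>] K by blast
  show "set_integrable lebesgue U (\<lambda>x. h x * frechet_derivative \<phi> (at x) e)"
    using \<phi> K by (intro *) (auto simp: C1c_def)
qed

text \<open>The indicator of \<open>K\<close> is reached from test functions by two limits. Test
  functions converge to the indicator of a finite union \<open>W\<close> of balls covering
  \<open>K\<close>; then the radius tends to 0 and \<open>W\<close> shrinks to \<open>K\<close>.
  Both limits use dominated convergence.\<close>

lemma set_integral_compact_nonneg: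
  fixes h :: "'a::euclidean_space \<Rightarrow> real"
  assumes U: "open U" and h: "locally_integrable U h"
    and nn: "\<And>\<phi>. \<phi> \<in> C1c U \<Longrightarrow> (\<And>x. 0 \<le> \<phi> x) \<Longrightarrow> 0 \<le> set_lebesgue_integral lebesgue U (\<lambda>x. h x * \<phi> x)"
    and K: "compact K" "K \<subseteq> U"
  shows "0 \<le> set_lebesgue_integral lebesgue K h"
proof (cases "K = {}")
  case False
  obtain \<delta> where \<delta>: "\<delta> > 0" "{x. infdist x K \<le> \<delta>} \<subseteq> U"
    using compact_in_open_separated[OF False K(1) U K(2)] by metis
  \<comment> \<open>\<open>h\<close> may fail to be integrable on \<open>U\<close>; on this compact
    neighbourhood of \<open>K\<close> it is integrable, and its absolute value there dominates both
    limits.\<close>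
  define K' where "K' = {x. infdist x K \<le> \<delta>}"
  have K': "compact K'" "K' \<subseteq> U"
    unfolding K'_def using compact_infdist_le[OF False K(1) \<delta>(1)] \<delta>(2) by auto
  have hK': "integrable lebesgue (\<lambda>x. indicat_real K' x * h x)"
    using h K' by (simp add: locally_integrable_def set_integrable_def)
  then have habs: "integrable lebesgue (\<lambda>x. \<bar>indicat_real K' x * h x\<bar>)" by (rule integrable_abs)
  have near: "infdist y K \<le> \<rho>" if "x \<in> K" "y \<in> cball x \<rho>" for x y \<rho>
    using infdist_le2[OF that(1), of y \<rho>] that(2) by (simp add: dist_commute)
  have "\<exists>W. open W \<and> K \<subseteq> W \<and> W \<subseteq> {x. infdist x K \<le> \<delta> / Suc n}
          \<and> 0 \<le> (LINT x|lebesgue. indicat_real W x * (indicat_real K' x * h x))" for n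
  proof -
    \<comment> \<open>Since \<open>\<rho> \<le> \<delta>\<close>, the closed balls of this radius
      with centre in \<open>K\<close> stay in \<open>K'\<close>.\<close>
    define \<rho> where "\<rho> = \<delta> / Suc n"
    have \<rho>: "0 < \<rho>" "\<rho> \<le> \<delta>" using \<delta>(1) by (auto simp: \<rho>_def divide_le_eq intro!: mult_left_mono[of 1 _ \<delta>, simplified])
    obtain S where S: "S \<subseteq> K" "finite S" "K \<subseteq> (\<Union>x\<in>S. ball x \<rho>)"
      using compactE_image[OF K(1), of K "\<lambda>x. ball x \<rho>"] \<rho> by (metis UN_I centre_in_ball open_ball subsetI)
    define F where "F = (\<lambda>x. (x, \<rho>)) ` S"
    define W where "W = (\<Union>x\<in>S. ball x \<rho>)"
    have "open W" unfolding W_def by blast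
    then have Ws: "W \<in> sets lebesgue" by auto
    have WF: "(\<Union>(c, \<rho>)\<in>F. ball c \<rho>) = W" by (auto simp: F_def W_def)
    have cb: "cball c \<rho> \<subseteq> K'" if "c \<in> K" for c
      using near[OF that, of _ \<rho>] \<rho> by (force simp: K'_def)
    have "finite F" using S(2) by (simp add: F_def)
    moreover have "\<sigma> > 0 \<and> cball c \<sigma> \<subseteq> U" if "(c, \<sigma>) \<in> F" for c \<sigma>
    proof -
      have "c \<in> S" "\<sigma> = \<rho>" using that by (auto simp: F_def)
      then show ?thesis using S(1) \<rho>(1) order_trans[OF cb K'(2)] by blast
    qed
    ultimately obtain \<phi> :: "nat \<Rightarrow> 'a \<Rightarrow> real" where \<phi>: "\<And>k. \<phi> k \<in> C1c U" "\<And>k x. 0 \<le> \<phi> k x" "\<And>k x. \<phi> k x \<le> 1"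
      "\<And>k x. x \<notin> W \<Longrightarrow> \<phi> k x = 0" "\<And>x. (\<lambda>k. \<phi> k x) \<longlonglongrightarrow> indicator W x"
      using C1c_approx_balls[of F U] unfolding WF by metis
    have WK': "W \<subseteq> K'" using cb S(1) ball_subset_cball unfolding W_def by blast
    have \<phi>m: "\<phi> k \<in> borel_measurable lebesgue" for k
      using borel_measurable_continuous_onI[OF C1c_continuous[OF \<phi>(1)[of k]]] by (simp add: measurable_completion)
    have "(\<lambda>k. LINT x|lebesgue. \<phi> k x * (indicat_real K' x * h x))
        \<longlonglongrightarrow> (LINT x|lebesgue. indicat_real W x * (indicat_real K' x * h x))"
    proof (rule integral_dominated_convergence[OF _ _ habs])
      show "AE x in lebesgue. (\<lambda>k. \<phi> k x * (indicat_real K' x * h x)) \<longlonglongrightarrow> indicat_real W x * (indicat_real K' x * h x)"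
        using \<phi>(5) by (auto intro!: tendsto_intros)
      show "AE x in lebesgue. norm (\<phi> k x * (indicat_real K' x * h x)) \<le> \<bar>indicat_real K' x * h x\<bar>" for k
        using \<phi>(2,3) by (auto simp: abs_mult intro!: mult_left_le_one_le)
      show "(\<lambda>x. indicat_real W x * (indicat_real K' x * h x)) \<in> borel_measurable lebesgue"
        using Ws by (intro borel_measurable_times[OF borel_measurable_indicator borel_measurable_integrable[OF hK']])
      show "(\<lambda>x. \<phi> k x * (indicat_real K' x * h x)) \<in> borel_measurable lebesgue" for k
        by (rule borel_measurable_times[OF \<phi>m borel_measurable_integrable[OF hK']])
    qed
    moreover have "0 \<le> (LINT x|lebesgue. \<phi> k x * (indicat_real K' x * h x))" for k
    proof -
      have "(\<lambda>x. \<phi> k x * (indicat_real K' x * h x)) = (\<lambda>x. indicat_real U x *\<^sub>R (h x * \<phi> k x))"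
      proof
        fix x
        show "\<phi> k x * (indicat_real K' x * h x) = indicat_real U x *\<^sub>R (h x * \<phi> k x)"
          using WK' K'(2) \<phi>(4)[of x k] by (cases "x \<in> W") (auto simp: indicator_def)
      qed
      then show ?thesis using nn[OF \<phi>(1) \<phi>(2), of k] by (simp add: set_lebesgue_integral_def)
    qed
    ultimately have "0 \<le> (LINT x|lebesgue. indicat_real W x * (indicat_real K' x * h x))"
      by (intro LIMSEQ_le_const) auto
    moreover have "W \<subseteq> {x. infdist x K \<le> \<delta> / Suc n}"
      using near S(1) ball_subset_cball unfolding W_def \<rho>_def by blast
    ultimately show ?thesis using S(3) by (intro exI[of _ W]) (auto simp: W_def)
  qed
  then have "\<exists>W. \<forall>n. open (W n) \<and> K \<subseteq> W n \<and> W n \<subseteq> {x. infdist x K \<le> \<delta> / Suc n}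
          \<and> 0 \<le> (LINT x|lebesgue. indicat_real (W n) x * (indicat_real K' x * h x))"
    by (intro choice allI)
  then obtain W where W: "\<And>n. open (W n)" "\<And>n. K \<subseteq> W n" "\<And>n. W n \<subseteq> {x. infdist x K \<le> \<delta> / Suc n}"
     "\<And>n::nat. 0 \<le> (LINT x|lebesgue. indicat_real (W n) x * (indicat_real K' x * h x))"
    by blast
  have "(\<lambda>n. LINT x|lebesgue. indicat_real (W n) x * (indicat_real K' x * h x))
      \<longlonglongrightarrow> (LINT x|lebesgue. indicat_real K x * (indicat_real K' x * h x))"
  proof (rule integral_dominated_convergence[OF _ _ habs])
    have "(\<lambda>n. indicat_real (W n) x) \<longlonglongrightarrow> indicat_real K x" for x
    proof (cases "x \<in> K")
      case True
      then show ?thesis using W(2) by (simp add: subset_iff)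
    next
      case False
      then have "infdist x K > 0"
        by (rule infdist_pos_not_in_closed[OF compact_imp_closed[OF K(1)] \<open>K \<noteq> {}\<close>])
      moreover have "(\<lambda>n. \<delta> / Suc n) \<longlonglongrightarrow> 0"
        using tendsto_mult_right_zero[OF LIMSEQ_Suc[OF lim_1_over_n], of \<delta>] by simp
      ultimately have "\<forall>\<^sub>F n in sequentially. \<delta> / Suc n < infdist x K" by (intro order_tendstoD) auto
      then have "\<forall>\<^sub>F n in sequentially. indicat_real (W n) x = 0"
        by eventually_elim (use W(3) in \<open>force simp: indicator_def\<close>)
      then show ?thesis using False by (simp add: tendsto_eventually)
    qed
    then show "AE x in lebesgue. (\<lambda>n. indicat_real (W n) x * (indicat_real K' x * h x)) \<longlonglongrightarrow> indicat_real K x * (indicat_real K' x * h x)"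
      by (auto intro!: tendsto_intros)
    show "AE x in lebesgue. norm (indicat_real (W n) x * (indicat_real K' x * h x)) \<le> \<bar>indicat_real K' x * h x\<bar>" for n
      by (auto simp: indicator_def)
    show "(\<lambda>x. indicat_real K x * (indicat_real K' x * h x)) \<in> borel_measurable lebesgue"
      using K(1) by (intro borel_measurable_times[OF borel_measurable_indicator borel_measurable_integrable[OF hK']])
         (simp add: lmeasurable_compact fmeasurableD)
    show "(\<lambda>x. indicat_real (W n) x * (indicat_real K' x * h x)) \<in> borel_measurable lebesgue" for n
      using W(1)[of n] by (intro borel_measurable_times[OF borel_measurable_indicator borel_measurable_integrable[OF hK']]) auto
  qed
  then have "0 \<le> (LINT x|lebesgue. indicat_real K x * (indicat_real K' x * h x))"
    by (rule LIMSEQ_le_const) (use W(4) in auto)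
  also have "(\<lambda>x. indicat_real K x * (indicat_real K' x * h x)) = (\<lambda>x. indicat_real K x *\<^sub>R h x)"
    using \<delta>(1) by (auto simp: fun_eq_iff indicator_def K'_def)
  finally show ?thesis by (simp add: set_lebesgue_integral_def)
qed (simp add: set_lebesgue_integral_def)

text \<open>On a compact subset of \<open>{h < 0}\<close> the integral of \<open>h\<close> is
  nonnegative by the preceding lemma, while the integrand is negative; so every such subset is null.
  Inner regularity passes this on to the whole set.\<close>

lemma nonneg_AE_if_test_nonneg:
  fixes h :: "'a::euclidean_space \<Rightarrow> real"
  assumes U: "open U" and h: "locally_integrable U h"
    and nn: "\<And>\<phi>. \<phi> \<in> C1c U \<Longrightarrow> (\<And>x. 0 \<le> \<phi> x) \<Longrightarrow> 0 \<le> set_lebesgue_integral lebesgue U (\<lambda>x. h x * \<phi> x)"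
  shows "AE x in lebesgue_on U. 0 \<le> h x"
proof -
  define S where "S = {x\<in>U. h x < 0}"
  have hm: "h \<in> borel_measurable (lebesgue_on U)" using locally_integrable_measurable U h by blast
  have "{x \<in> space (lebesgue_on U). h x < 0} \<in> sets (lebesgue_on U)"
    using hm by (intro borel_measurable_less) auto
  then have S: "S \<in> sets lebesgue"
    using U by (auto simp: S_def sets_restrict_space_iff)
  have null: "K \<in> null_sets lebesgue" if K: "compact K" "K \<subseteq> S" for K
  proof -
    have KU: "K \<subseteq> U" using K(2) by (auto simp: S_def)
    have i: "integrable lebesgue (\<lambda>x. indicat_real K x * h x)"
      using h K KU by (simp add: locally_integrable_def set_integrable_def)
    have "0 \<le> (LINT x|lebesgue. indicat_real K x * h x)"
      using set_integral_compact_nonneg[OF U h nn K(1) KU] by (simp add: set_lebesgue_integral_def)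
    moreover have "0 \<le> (LINT x|lebesgue. - (indicat_real K x * h x))"
      using K(2) by (intro Bochner_Integration.integral_nonneg) (auto simp: indicator_def S_def)
    ultimately have "(LINT x|lebesgue. - (indicat_real K x * h x)) = 0" by simp
    then have "AE x in lebesgue. - (indicat_real K x * h x) = 0"
    proof (subst (asm) integral_nonneg_eq_0_iff_AE)
      have "indicat_real K x * h x \<le> 0" for x using K(2) by (auto simp: indicator_def S_def)
      then show "AE x in lebesgue. 0 \<le> - (indicat_real K x * h x)" by simp
    qed (use i in simp_all)
    then have "AE x in lebesgue. x \<notin> K"
      by eventually_elim (use K(2) in \<open>auto simp: indicator_def S_def split: if_splits\<close>)
    moreover have "K \<in> sets lebesgue" using K(1) by (simp add: lmeasurable_compact fmeasurableD)
    ultimately show ?thesis by (simp add: AE_iff_null_sets)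
  qed
  have "S \<in> null_sets lebesgue"
  proof -
    have "emeasure lebesgue S \<le> 0 + ennreal e" if "e > 0" for e
    proof -
      obtain T where T: "closed T" "T \<subseteq> S" "S - T \<in> lmeasurable" "emeasure lebesgue (S - T) < ennreal e"
        using sets_lebesgue_inner_closed[OF S \<open>e > 0\<close>] by metis
      \<comment> \<open>Inner regularity yields closed sets, which need not be compact; intersecting
        with balls makes them so.\<close>
      have "T = (\<Union>n::nat. T \<inter> cball 0 (real n))" using real_arch_simple by (fastforce simp: set_eq_iff)
      moreover have "(\<Union>n::nat. T \<inter> cball 0 (real n)) \<in> null_sets lebesgue"
        using T by (intro null_sets_UN null closed_Int_compact) auto
      ultimately have "T \<in> null_sets lebesgue" by simp
      then have "emeasure lebesgue (S - T) = emeasure lebesgue S"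
        using S by (intro emeasure_Diff_null_set) auto
      then show ?thesis using T(4) by simp
    qed
    then have "emeasure lebesgue S \<le> 0" by (rule ennreal_le_epsilon)
    then have "emeasure lebesgue S = 0" by (simp only: le_zero_eq)
    with S show ?thesis by (rule null_setsI[rotated])
  qed
  then have "AE x in lebesgue. x \<notin> S" by (rule AE_not_in)
  then have "AE x in lebesgue. x \<in> U \<longrightarrow> 0 \<le> h x"
    by (rule eventually_mono) (auto simp: S_def not_less)
  then show ?thesis using U by (simp add: AE_restrict_space_iff)
qed

section \<open>Weak gradients of Lipschitz functions\<close>

lemma continuous_measurable_lebesgue:
  "continuous_on UNIV f \<Longrightarrow> f \<in> borel_measurable lebesgue"
  for f :: "'a::euclidean_space \<Rightarrow> 'b::euclidean_space"
  using borel_measurable_continuous_onI[of f] by (intro measurable_completion) simp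

lemma integrable_continuous_compact_support:
  fixes f :: "'a::euclidean_space \<Rightarrow> real"
  assumes "continuous_on UNIV f" "compact K" "\<And>x. x \<notin> K \<Longrightarrow> f x = 0"
  shows "integrable lebesgue f"
proof -
  have "integrable lborel (\<lambda>x. indicator K x *\<^sub>R f x)"
    using assms(1,2) continuous_on_subset by (intro borel_integrable_compact) auto
  moreover have "(\<lambda>x. indicator K x *\<^sub>R f x) = f"
    using assms(3) by (auto simp: fun_eq_iff indicator_def)
  ultimately show ?thesis
    using borel_measurable_continuous_onI[OF assms(1)] by (simp add: integrable_completion)
qed

lemma lebesgue_integral_shift:
  fixes f :: "'a::euclidean_space \<Rightarrow> real"
  assumes "continuous_on UNIV f"
  shows "(LINT x|lebesgue. f (x + a)) = (LINT x|lebesgue. f x)"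
proof -
  have fm: "f \<in> borel_measurable borel" using borel_measurable_continuous_onI[OF assms] .
  have c: "continuous_on UNIV (\<lambda>x. f (x + a))"
    by (intro continuous_on_compose2[OF assms] continuous_intros) auto
  have "(LINT x|lebesgue. f x) = (LINT x|distr lborel borel ((+) a). f x)"
    unfolding lborel_distr_plus by (simp add: integral_completion fm)
  also have "\<dots> = (LINT x|lborel. f (a + x))" using fm by (intro integral_distr) auto
  also have "\<dots> = (LINT x|lebesgue. f (x + a))"
    using borel_measurable_continuous_onI[OF c] by (simp add: integral_completion add.commute)
  finally show ?thesis ..
qed

lemma set_lebesgue_integral_vanishing_outside:
  assumes "\<And>x. x \<notin> U \<Longrightarrow> f x = 0"
  shows "set_lebesgue_integral M U f = (LINT x|M. f x)"
  unfolding set_lebesgue_integral_def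
  by (rule arg_cong[where f="integral\<^sup>L M"]) (use assms in \<open>auto simp: fun_eq_iff indicator_def\<close>)

text \<open>Translation invariance of the integral moves the difference quotient from
  \<open>u\<close> to \<open>\<phi>\<close>. There it converges pointwise to minus the directional
  derivative, and the mean value theorem bounds it uniformly, so dominated convergence
  applies.\<close>

lemma difference_quotient_weak_limit:
  fixes u \<phi> :: "'a::euclidean_space \<Rightarrow> real"
  assumes u: "continuous_on UNIV u" and \<phi>: "\<phi> \<in> C1c U"
  shows "(\<lambda>m. LINT x|lebesgue. real (Suc m) * (u (x + (1 / real (Suc m)) *\<^sub>R e) - u x) * \<phi> x)
    \<longlonglongrightarrow> - (LINT x|lebesgue. u x * frechet_derivative \<phi> (at x) e)"
proof -
  obtain K where K: "compact K" "K \<subseteq> U" "\<And>x. x \<notin> K \<Longrightarrow> \<phi> x = 0"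
    "\<And>x. x \<notin> K \<Longrightarrow> frechet_derivative \<phi> (at x) = (\<lambda>h. 0)"
    using C1c_support[OF \<phi>] by metis
  define \<psi> where "\<psi> x = frechet_derivative \<phi> (at x) e" for x
  have \<psi>c: "continuous_on UNIV \<psi>" using \<phi> by (auto simp: C1c_def \<psi>_def)
  have \<phi>c: "continuous_on UNIV \<phi>" by (rule C1c_continuous[OF \<phi>])
  obtain R where R: "\<And>x. x \<in> K \<Longrightarrow> norm x \<le> R" using compact_imp_bounded[OF K(1)] by (auto simp: bounded_iff)
  \<comment> \<open>The step lengths are at most 1, so this ball contains the supports of
    \<open>\<phi>\<close> and of all its translates; every quotient \<open>q m\<close> vanishes
    outside it.\<close>
  define S where "S = cball (0::'a) (R + norm e)"
  have S: "compact S" by (simp add: S_def)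
  obtain B where B: "\<And>x. x \<in> S \<Longrightarrow> \<bar>u x\<bar> \<le> B"
    using compact_imp_bounded[OF compact_continuous_image[OF continuous_on_subset[OF u] S]]
    by (auto simp: bounded_iff)
  obtain B' where B': "\<And>x. x \<in> K \<Longrightarrow> \<bar>\<psi> x\<bar> \<le> B'"
    using compact_imp_bounded[OF compact_continuous_image[OF continuous_on_subset[OF \<psi>c] K(1)]]
    by (auto simp: bounded_iff)
  define C where "C = max B' 0"
  have C: "\<bar>\<psi> x\<bar> \<le> C" "0 \<le> C" for x
    using B'[of x] K(4)[of x] by (cases "x \<in> K"; auto simp: C_def \<psi>_def)+
  define h where "h m = 1 / real (Suc m)" for m
  have h: "0 < h m" "h m \<le> 1" "real (Suc m) = 1 / h m" for m by (auto simp: h_def)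
  have der: "((\<lambda>t. \<phi> (x - t *\<^sub>R e)) has_real_derivative - \<psi> (x - t *\<^sub>R e)) (at t)" for x t
  proof -
    interpret linear "frechet_derivative \<phi> (at (x - t *\<^sub>R e))"
      using C1c_has_derivative[OF \<phi>] has_derivative_linear by blast
    have "((\<lambda>t. x - t *\<^sub>R e) has_derivative (\<lambda>s. - (s *\<^sub>R e))) (at t)"
      by (auto intro!: derivative_eq_intros)
    from has_derivative_compose[OF this C1c_has_derivative[OF \<phi>]]
    have "((\<lambda>t. \<phi> (x - t *\<^sub>R e)) has_derivative (\<lambda>s. frechet_derivative \<phi> (at (x - t *\<^sub>R e)) (- (s *\<^sub>R e)))) (at t)" .
    moreover have "(\<lambda>s. frechet_derivative \<phi> (at (x - t *\<^sub>R e)) (- (s *\<^sub>R e))) = (*) (- \<psi> (x - t *\<^sub>R e))"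
      unfolding \<psi>_def by (simp add: fun_eq_iff neg scale mult.commute)
    ultimately show ?thesis unfolding has_field_derivative_def by simp
  qed
  define q where "q m x = (\<phi> (x - h m *\<^sub>R e) - \<phi> x) / h m" for m x
  have qlim: "(\<lambda>m. q m x) \<longlonglongrightarrow> - \<psi> x" for x
  proof -
    have "((\<lambda>s. (\<phi> (x - s *\<^sub>R e) - \<phi> x) / s) \<longlongrightarrow> - \<psi> x) (at 0)"
      using der[of x 0] by (simp add: DERIV_def)
    moreover have "filterlim h (at 0) sequentially" unfolding filterlim_at
    proof
      show "\<forall>\<^sub>F m in sequentially. h m \<in> UNIV \<and> h m \<noteq> 0"
        using h(1) by (auto intro!: always_eventually simp: less_imp_neq[THEN not_sym])
      show "h \<longlonglongrightarrow> 0" unfolding h_def by (rule LIMSEQ_Suc[OF lim_1_over_n])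
    qed
    ultimately show ?thesis unfolding q_def by (rule filterlim_compose)
  qed
  have qbd: "\<bar>q m x\<bar> \<le> C" for m x
  proof -
    obtain z where "0 < z" "z < h m" "\<phi> (x - h m *\<^sub>R e) - \<phi> (x - 0 *\<^sub>R e) = (h m - 0) * (- \<psi> (x - z *\<^sub>R e))"
      using MVT2[OF h(1)[of m], of "\<lambda>t. \<phi> (x - t *\<^sub>R e)" "\<lambda>t. - \<psi> (x - t *\<^sub>R e)"] der by blast
    then have "q m x = - \<psi> (x - z *\<^sub>R e)" using h(1)[of m] by (simp add: q_def)
    then show ?thesis using C(1) by simp
  qed
  have outS: "x \<notin> K \<and> x - h m *\<^sub>R e \<notin> K" if "x \<notin> S" for x m
  proof -
    have "norm (h m *\<^sub>R e) \<le> norm e" using h[of m] by (simp add: mult_left_le_one_le)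
    moreover have "norm x > R + norm e" using that by (simp add: S_def)
    ultimately have "norm x > R" "norm (x - h m *\<^sub>R e) > R"
      using norm_ge_zero[of e] norm_triangle_ineq2[of x "h m *\<^sub>R e"] by linarith+
    then show ?thesis using R by force
  qed
  have q0: "q m x = 0" if "x \<notin> S" for m x using outS[OF that] K(3) by (simp add: q_def)
  have qc: "continuous_on UNIV (q m)" for m unfolding q_def using h(1)[of m]
    by (intro continuous_intros continuous_on_compose2[OF \<phi>c] \<phi>c) auto
  have eq: "(LINT x|lebesgue. real (Suc m) * (u (x + (1 / real (Suc m)) *\<^sub>R e) - u x) * \<phi> x)
      = (LINT x|lebesgue. u x * q m x)" for m
  proof -
    have c: "continuous_on UNIV (\<lambda>x. u x * \<phi> (x - h m *\<^sub>R e))"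
      by (intro continuous_intros continuous_on_compose2[OF \<phi>c] u) auto
    have i1: "integrable lebesgue (\<lambda>x. u x * \<phi> (x - h m *\<^sub>R e))"
      using outS K(3) by (intro integrable_continuous_compact_support[OF c S]) auto
    have i2: "integrable lebesgue (\<lambda>x. u x * \<phi> x)"
      using K by (intro integrable_continuous_compact_support[OF _ K(1)] continuous_intros u \<phi>c) auto
    have i3: "integrable lebesgue (\<lambda>x. u (x + h m *\<^sub>R e) * \<phi> x)"
      using K by (intro integrable_continuous_compact_support[OF _ K(1)] continuous_intros continuous_on_compose2[OF u] \<phi>c) auto
    have "(LINT x|lebesgue. real (Suc m) * (u (x + (1 / real (Suc m)) *\<^sub>R e) - u x) * \<phi> x)
      = (LINT x|lebesgue. (u (x + h m *\<^sub>R e) * \<phi> x - u x * \<phi> x) / h m)"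
      unfolding h(3) by (simp add: algebra_simps diff_divide_distrib)
    also have "\<dots> = ((LINT x|lebesgue. u (x + h m *\<^sub>R e) * \<phi> x) - (LINT x|lebesgue. u x * \<phi> x)) / h m"
      using i2 i3 by simp
    also have "(LINT x|lebesgue. u (x + h m *\<^sub>R e) * \<phi> x) = (LINT x|lebesgue. u x * \<phi> (x - h m *\<^sub>R e))"
      using lebesgue_integral_shift[OF c, of "h m *\<^sub>R e"] by simp
    also have "((LINT x|lebesgue. u x * \<phi> (x - h m *\<^sub>R e)) - (LINT x|lebesgue. u x * \<phi> x)) / h m
       = (LINT x|lebesgue. (u x * \<phi> (x - h m *\<^sub>R e) - u x * \<phi> x) / h m)"
      using i1 i2 by simp
    also have "\<dots> = (LINT x|lebesgue. u x * q m x)"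
      by (simp add: q_def algebra_simps diff_divide_distrib)
    finally show ?thesis .
  qed
  have "(\<lambda>m. LINT x|lebesgue. u x * q m x) \<longlonglongrightarrow> (LINT x|lebesgue. u x * - \<psi> x)"
  proof (rule integral_dominated_convergence[where w="\<lambda>x. indicat_real S x * (B * C)"])
    show "AE x in lebesgue. (\<lambda>m. u x * q m x) \<longlonglongrightarrow> u x * - \<psi> x"
      by (intro AE_I2 tendsto_intros qlim)
    show "AE x in lebesgue. norm (u x * q m x) \<le> indicat_real S x * (B * C)" for m
    proof (intro AE_I2)
      fix x
      show "norm (u x * q m x) \<le> indicat_real S x * (B * C)"
      proof (cases "x \<in> S")
        case True
        have "\<bar>u x\<bar> * \<bar>q m x\<bar> \<le> B * C" using B[OF True] qbd[of m x] by (intro mult_mono) auto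
        then show ?thesis using True by (simp add: abs_mult)
      qed (use q0 in simp)
    qed
    show "integrable lebesgue (\<lambda>x. indicat_real S x * (B * C))"
      using lmeasurable_compact[OF S] by (intro integrable_mult_left) (auto simp: integrable_indicator_iff fmeasurable_def)
    show "(\<lambda>x. u x * - \<psi> x) \<in> borel_measurable lebesgue"
      by (intro continuous_measurable_lebesgue continuous_intros u \<psi>c)
    show "(\<lambda>x. u x * q m x) \<in> borel_measurable lebesgue" for m
      by (intro continuous_measurable_lebesgue continuous_intros u qc)
  qed
  then show ?thesis unfolding eq \<psi>_def by simp
qed

lemma bounded_locally_integrable:
  fixes f :: "'a::euclidean_space \<Rightarrow> 'b::euclidean_space"
  assumes "open U" "f \<in> borel_measurable (lebesgue_on U)" "\<And>x. x \<in> U \<Longrightarrow> norm (f x) \<le> B"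
  shows "locally_integrable U f"
  unfolding locally_integrable_def
proof (intro allI impI)
  fix K assume K: "compact K \<and> K \<subseteq> U"
  then have Ks: "K \<in> sets lebesgue" "emeasure lebesgue K < \<infinity>"
    using lmeasurable_compact[of K] by (auto simp: fmeasurable_def)
  have "(\<lambda>x. indicat_real U x *\<^sub>R f x) \<in> borel_measurable lebesgue"
    using assms(1,2) by (simp add: borel_measurable_restrict_space_iff)
  then have "(\<lambda>x. indicat_real K x *\<^sub>R (indicat_real U x *\<^sub>R f x)) \<in> borel_measurable lebesgue"
    by (rule borel_measurable_scaleR[OF borel_measurable_indicator[OF Ks(1)]])
  moreover have "(\<lambda>x. indicat_real K x *\<^sub>R (indicat_real U x *\<^sub>R f x)) = (\<lambda>x. indicat_real K x *\<^sub>R f x)"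
    using K by (auto simp: fun_eq_iff indicator_def)
  ultimately have "(\<lambda>x. indicat_real K x *\<^sub>R f x) \<in> borel_measurable lebesgue" by simp
  then show "set_integrable lebesgue K f" unfolding set_integrable_def
    using K assms(3) Ks
    by (intro integrableI_bounded_set[where A=K and B=B]) (auto intro!: AE_I2)
qed

text \<open>In each coordinate direction the difference quotients are bounded by \<open>L\<close>,
  and their integrals against test functions converge to the value required of a weak derivative. A
  weak limit of the quotients is therefore a component of the gradient.\<close>

lemma Lipschitz_has_weak_gradient:
  fixes u :: "'a::euclidean_space \<Rightarrow> real"
  assumes U: "open U" "bounded U" and u: "L-lipschitz_on UNIV u"
  shows "\<exists>G. has_weak_gradient U u G"
proof -
  have uc: "continuous_on UNIV u" using lipschitz_on_continuous_on[OF u] .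
  have L0: "L \<ge> 0" using lipschitz_on_nonneg[OF u] .
  have Us: "U \<in> sets lebesgue" using U by auto
  have fin: "finite_measure (lebesgue_on U)"
    using U Us by (intro finite_measure_lebesgue_on bounded_set_imp_lmeasurable)
  have li: "LINT x|lebesgue_on U. f x = set_lebesgue_integral lebesgue U f" for f :: "'a \<Rightarrow> real"
    using Us by (simp add: integral_restrict_space set_lebesgue_integral_def)
  have "\<exists>G. G \<in> borel_measurable (lebesgue_on U) \<and> (\<forall>x. \<bar>G x\<bar> \<le> L) \<and>
     (\<forall>\<phi>\<in>C1c U. (LINT x|lebesgue_on U. G x * \<phi> x)
        = - set_lebesgue_integral lebesgue U (\<lambda>x. u x * frechet_derivative \<phi> (at x) i))"
    if i: "i \<in> Basis" for i
  proof -
    define D where "D m x = real (Suc m) * (u (x + (1 / real (Suc m)) *\<^sub>R i) - u x)" for m x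
    have Dc: "continuous_on UNIV (D m)" for m unfolding D_def
      by (intro continuous_intros continuous_on_compose2[OF uc] uc) auto
    have Dm: "D m \<in> borel_measurable (lebesgue_on U)" for m
      by (rule measurable_restrict_space1[OF continuous_measurable_lebesgue[OF Dc]])
    have Db: "\<bar>D m x\<bar> \<le> L" for m x
    proof -
      have "\<bar>u (x + (1 / real (Suc m)) *\<^sub>R i) - u x\<bar> \<le> L * (1 / real (Suc m))"
        using lipschitz_onD[OF u, of "x + (1 / real (Suc m)) *\<^sub>R i" x] i by (simp add: dist_norm)
      from mult_left_mono[OF this, of "real (Suc m)"] show ?thesis
        by (simp add: D_def abs_mult del: of_nat_Suc)
    qed
    have T: "integrable (lebesgue_on U) \<phi>" if "\<phi> \<in> C1c U" for \<phi> :: "'a \<Rightarrow> real"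
    proof -
      obtain K where "compact K" "\<And>x. x \<notin> K \<Longrightarrow> \<phi> x = 0"
        using C1c_support[OF \<open>\<phi> \<in> C1c U\<close>] by metis
      then show ?thesis
        using integrable_continuous_compact_support[OF C1c_continuous[OF that]] Us
        by (auto simp: integrable_restrict_space intro: integrable_mult_indicator[where f=\<phi>, simplified])
    qed
    have lim: "(\<lambda>m. LINT x|lebesgue_on U. D m x * \<phi> x)
        \<longlonglongrightarrow> - set_lebesgue_integral lebesgue U (\<lambda>x. u x * frechet_derivative \<phi> (at x) i)"
      if \<phi>: "\<phi> \<in> C1c U" for \<phi>
    proof -
      obtain K where K: "K \<subseteq> U" "\<And>x. x \<notin> K \<Longrightarrow> \<phi> x = 0"
        "\<And>x. x \<notin> K \<Longrightarrow> frechet_derivative \<phi> (at x) = (\<lambda>h. 0)"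
        using C1c_support[OF \<phi>] by metis
      have 1: "(LINT x|lebesgue_on U. D m x * \<phi> x) = (LINT x|lebesgue. D m x * \<phi> x)" for m
        unfolding li using K by (intro set_lebesgue_integral_vanishing_outside) auto
      have 2: "set_lebesgue_integral lebesgue U (\<lambda>x. u x * frechet_derivative \<phi> (at x) i)
          = (LINT x|lebesgue. u x * frechet_derivative \<phi> (at x) i)"
      proof (rule set_lebesgue_integral_vanishing_outside)
        fix x assume "x \<notin> U"
        then have "x \<notin> K" using K by auto
        then show "u x * frechet_derivative \<phi> (at x) i = 0" using K(3) by simp
      qed
      show ?thesis unfolding 1 2 using difference_quotient_weak_limit[OF uc \<phi>, of i] by (simp add: D_def)
    qed
    show ?thesis
    proof (rule bounded_sequence_weak_limit[OF fin Dm Db T lim])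
      fix G assume "G \<in> borel_measurable (lebesgue_on U)" "\<And>x. \<bar>G x\<bar> \<le> L"
        "\<And>\<phi>. \<phi> \<in> C1c U \<Longrightarrow> (LINT x|lebesgue_on U. G x * \<phi> x)
          = - set_lebesgue_integral lebesgue U (\<lambda>x. u x * frechet_derivative \<phi> (at x) i)"
      then show ?thesis by (intro exI[of _ G]) simp
    qed
  qed
  then have "\<exists>G. \<forall>i\<in>Basis. G i \<in> borel_measurable (lebesgue_on U) \<and> (\<forall>x. \<bar>G i x\<bar> \<le> L) \<and>
     (\<forall>\<phi>\<in>C1c U. (LINT x|lebesgue_on U. G i x * \<phi> x)
        = - set_lebesgue_integral lebesgue U (\<lambda>x. u x * frechet_derivative \<phi> (at x) i))"
    by (intro bchoice ballI)
  then obtain G where G: "\<And>i. i \<in> Basis \<Longrightarrow> G i \<in> borel_measurable (lebesgue_on U)"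
    "\<And>i x. i \<in> Basis \<Longrightarrow> \<bar>G i x\<bar> \<le> L"
    "\<And>i \<phi>. i \<in> Basis \<Longrightarrow> \<phi> \<in> C1c U \<Longrightarrow> (LINT x|lebesgue_on U. G i x * \<phi> x)
        = - set_lebesgue_integral lebesgue U (\<lambda>x. u x * frechet_derivative \<phi> (at x) i)"
    by blast
  define H where "H x = (\<Sum>i\<in>Basis. G i x *\<^sub>R i)" for x
  have Hi: "H x \<bullet> i = G i x" if "i \<in> Basis" for x i
    using that by (simp add: H_def inner_sum_left inner_Basis if_distrib[of "\<lambda>a. _ * a"] cong: if_cong)
  have Hm: "H \<in> borel_measurable (lebesgue_on U)" unfolding H_def using G(1) by measurable
  \<comment> \<open>This crude bound serves local integrability only; the sharp constant
    \<open>L\<close> is proved afterwards for every weak gradient.\<close>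
  have Hb: "norm (H x) \<le> real DIM('a) * L" for x
  proof -
    have "norm (H x) \<le> (\<Sum>i\<in>Basis. \<bar>H x \<bullet> i\<bar>)" by (rule norm_le_l1)
    also have "\<dots> \<le> (\<Sum>i\<in>(Basis::'a set). L)" using Hi G(2) by (intro sum_mono) simp
    finally show ?thesis by simp
  qed
  have "locally_integrable U u"
    unfolding locally_integrable_def
  proof (intro allI impI)
    fix K assume "compact K \<and> K \<subseteq> U"
    then have "integrable lborel (\<lambda>x. indicator K x *\<^sub>R u x)"
      using uc continuous_on_subset by (intro borel_integrable_compact) auto
    then show "set_integrable lebesgue K u"
      by (simp add: set_integrable_def integrable_completion)
  qed
  moreover have "locally_integrable U H" using bounded_locally_integrable[OF U(1) Hm Hb] .
  ultimately have "has_weak_gradient U u H"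
    unfolding has_weak_gradient_def li[symmetric] using G(3) Hi by (simp add: li)
  then show ?thesis by (rule exI[where x=H])
qed

lemma set_integral_linear_combination:
  fixes f :: "'i \<Rightarrow> 'a \<Rightarrow> real"
  assumes "\<And>i. i \<in> I \<Longrightarrow> set_integrable M U (f i)"
  shows "set_lebesgue_integral M U (\<lambda>x. \<Sum>i\<in>I. c i * f i x) = (\<Sum>i\<in>I. c i * set_lebesgue_integral M U (f i))"
proof -
  have "set_lebesgue_integral M U (\<lambda>x. \<Sum>i\<in>I. c i * f i x)
      = (LINT x|M. (\<Sum>i\<in>I. c i * (indicat_real U x *\<^sub>R f i x)))"
    unfolding set_lebesgue_integral_def by (simp add: sum_distrib_left mult.left_commute)
  also have "\<dots> = (\<Sum>i\<in>I. (LINT x|M. c i * (indicat_real U x *\<^sub>R f i x)))"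
    using assms unfolding set_integrable_def by (intro Bochner_Integration.integral_sum integrable_mult_right)
  finally show ?thesis by (simp add: set_lebesgue_integral_def)
qed

text \<open>The definition tests coordinate directions only. Linearity of the derivative extends the
  identity to every direction, as an estimate of the Euclidean norm with the right constant
  requires.\<close>

lemma weak_gradient_directional:
  fixes u :: "'a::euclidean_space \<Rightarrow> real"
  assumes U: "open U" and G: "has_weak_gradient U u G" and \<phi>: "\<phi> \<in> C1c U"
  shows "locally_integrable U (\<lambda>x. G x \<bullet> e)"
    and "set_lebesgue_integral lebesgue U (\<lambda>x. (G x \<bullet> e) * \<phi> x)
       = - set_lebesgue_integral lebesgue U (\<lambda>x. u x * frechet_derivative \<phi> (at x) e)"
proof -
  have l: "locally_integrable U u" "locally_integrable U G" using G by (auto simp: has_weak_gradient_def)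
  show li: "locally_integrable U (\<lambda>x. G x \<bullet> e)" for e
    unfolding locally_integrable_def
  proof (intro allI impI)
    fix K assume "compact K \<and> K \<subseteq> U"
    then have "integrable lebesgue (\<lambda>x. indicat_real K x *\<^sub>R G x)"
      using l(2) by (simp add: locally_integrable_def set_integrable_def)
    then have "integrable lebesgue (\<lambda>x. (indicat_real K x *\<^sub>R G x) \<bullet> e)"
      by (intro integrable_inner_left)
    then show "set_integrable lebesgue K (\<lambda>x. G x \<bullet> e)" by (simp add: set_integrable_def)
  qed
  have "frechet_derivative \<phi> (at x) e = (\<Sum>i\<in>Basis. (e \<bullet> i) * frechet_derivative \<phi> (at x) i)" for x
  proof -
    interpret linear "frechet_derivative \<phi> (at x)"
      using C1c_has_derivative[OF \<phi>] has_derivative_linear by blast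
    have "frechet_derivative \<phi> (at x) (\<Sum>i\<in>Basis. (e \<bullet> i) *\<^sub>R i) = (\<Sum>i\<in>Basis. (e \<bullet> i) *\<^sub>R frechet_derivative \<phi> (at x) i)"
      by (simp add: sum scale)
    then show ?thesis by (simp add: euclidean_representation)
  qed
  then have "set_lebesgue_integral lebesgue U (\<lambda>x. u x * frechet_derivative \<phi> (at x) e)
    = set_lebesgue_integral lebesgue U (\<lambda>x. \<Sum>i\<in>Basis. (e \<bullet> i) * (u x * frechet_derivative \<phi> (at x) i))"
    by (simp add: sum_distrib_left mult.left_commute)
  also have "\<dots> = (\<Sum>i\<in>Basis. (e \<bullet> i) * set_lebesgue_integral lebesgue U (\<lambda>x. u x * frechet_derivative \<phi> (at x) i))"
    by (rule set_integral_linear_combination[OF C1c_mult_integrable(2)[OF U l(1) \<phi>]])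
  also have "\<dots> = (\<Sum>i\<in>Basis. (e \<bullet> i) * - set_lebesgue_integral lebesgue U (\<lambda>x. (G x \<bullet> i) * \<phi> x))"
    using G \<phi> by (simp add: has_weak_gradient_def)
  also have "\<dots> = - (\<Sum>i\<in>Basis. (e \<bullet> i) * set_lebesgue_integral lebesgue U (\<lambda>x. (G x \<bullet> i) * \<phi> x))"
    by (simp add: sum_negf)
  also have "(\<Sum>i\<in>Basis. (e \<bullet> i) * set_lebesgue_integral lebesgue U (\<lambda>x. (G x \<bullet> i) * \<phi> x))
     = set_lebesgue_integral lebesgue U (\<lambda>x. \<Sum>i\<in>Basis. (e \<bullet> i) * ((G x \<bullet> i) * \<phi> x))"
    by (rule set_integral_linear_combination[OF C1c_mult_integrable(1)[OF U li \<phi>], symmetric])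
  also have "\<dots> = set_lebesgue_integral lebesgue U (\<lambda>x. (G x \<bullet> e) * \<phi> x)"
  proof -
    have "(\<Sum>i\<in>Basis. (e \<bullet> i) * ((G x \<bullet> i) * \<phi> x)) = (G x \<bullet> e) * \<phi> x" for x
      unfolding euclidean_inner[of "G x" e] by (simp add: sum_distrib_right sum_distrib_left mult_ac)
    then show ?thesis by simp
  qed
  finally show "set_lebesgue_integral lebesgue U (\<lambda>x. (G x \<bullet> e) * \<phi> x)
       = - set_lebesgue_integral lebesgue U (\<lambda>x. u x * frechet_derivative \<phi> (at x) e)" by simp
qed

text \<open>For a fixed direction \<open>e\<close>, the integral of \<open>G \<bullet> e\<close>
  against a nonnegative test function is a limit of integrals of difference quotients, each at most
  \<open>L * norm e\<close> times the integral of the test function. Hence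
  \<open>G \<bullet> e \<le> L * norm e\<close> almost everywhere. The null set depends on
  \<open>e\<close>, so a countable dense set of directions is used.\<close>

lemma norm_weak_gradient_Lipschitz_le:
  fixes u :: "'a::euclidean_space \<Rightarrow> real"
  assumes U: "open U" and G: "has_weak_gradient U u G" and u: "L-lipschitz_on UNIV u"
  shows "AE x in lebesgue_on U. norm (G x) \<le> L"
proof -
  have uc: "continuous_on UNIV u" using lipschitz_on_continuous_on[OF u] .
  have dir: "AE x in lebesgue_on U. 0 \<le> L * norm e - G x \<bullet> e" for e
  proof (rule nonneg_AE_if_test_nonneg[OF U])
    have cl: "locally_integrable U (\<lambda>x. L * norm e)"
      using U by (intro bounded_locally_integrable[where B="\<bar>L * norm e\<bar>"]) auto
    \<comment> \<open>The integrability claim of the directional lemma does not depend on the test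
      function; zero serves to instantiate it.\<close>
    have "(\<lambda>x. 0) \<in> C1c U" by (rule C1cI[where K="{}" and \<phi>'="\<lambda>x h. 0"]) auto
    note li = weak_gradient_directional(1)[OF U G this, of e]
    show "locally_integrable U (\<lambda>x. L * norm e - G x \<bullet> e)"
      using li cl unfolding locally_integrable_def by (auto intro!: set_integral_diff)
    fix \<phi> :: "'a \<Rightarrow> real" assume \<phi>: "\<phi> \<in> C1c U" "\<And>x. 0 \<le> \<phi> x"
    obtain K where K: "compact K" "K \<subseteq> U" "\<And>x. x \<notin> K \<Longrightarrow> \<phi> x = 0"
      "\<And>x. x \<notin> K \<Longrightarrow> frechet_derivative \<phi> (at x) = (\<lambda>h. 0)"
      using C1c_support[OF \<phi>(1)] by metis
    have \<phi>i: "integrable lebesgue \<phi>"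
      using integrable_continuous_compact_support[OF C1c_continuous[OF \<phi>(1)] K(1) K(3)] .
    have "set_lebesgue_integral lebesgue U (\<lambda>x. (G x \<bullet> e) * \<phi> x)
       = - (LINT x|lebesgue. u x * frechet_derivative \<phi> (at x) e)"
    proof -
      have "u x * frechet_derivative \<phi> (at x) e = 0" if "x \<notin> U" for x
      proof -
        have "frechet_derivative \<phi> (at x) = (\<lambda>h. 0)" using K(2,4) that by blast
        then show ?thesis by simp
      qed
      then show ?thesis
        unfolding weak_gradient_directional(2)[OF U G \<phi>(1)]
        by (simp add: set_lebesgue_integral_vanishing_outside)
    qed
    also have "\<dots> \<le> L * norm e * (LINT x|lebesgue. \<phi> x)"
    proof (rule LIMSEQ_le_const2[OF difference_quotient_weak_limit[OF uc \<phi>(1)]], intro exI allI impI)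
      fix m :: nat
      have "(LINT x|lebesgue. real (Suc m) * (u (x + (1 / real (Suc m)) *\<^sub>R e) - u x) * \<phi> x)
          \<le> (LINT x|lebesgue. L * norm e * \<phi> x)"
      proof (rule integral_mono)
        show "integrable lebesgue (\<lambda>x. real (Suc m) * (u (x + (1 / real (Suc m)) *\<^sub>R e) - u x) * \<phi> x)"
          using K by (intro integrable_continuous_compact_support[OF _ K(1)] continuous_intros
              continuous_on_compose2[OF uc] C1c_continuous[OF \<phi>(1)] uc) auto
        fix x
        have "u (x + (1 / real (Suc m)) *\<^sub>R e) - u x \<le> L * (norm e / real (Suc m))"
          using lipschitz_onD[OF u, of "x + (1 / real (Suc m)) *\<^sub>R e" x] by (simp add: dist_norm)
        then have "real (Suc m) * (u (x + (1 / real (Suc m)) *\<^sub>R e) - u x) \<le> L * norm e"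
          by (simp add: field_simps)
        then show "real (Suc m) * (u (x + (1 / real (Suc m)) *\<^sub>R e) - u x) * \<phi> x \<le> L * norm e * \<phi> x"
          using \<phi>(2) by (rule mult_right_mono)
      qed (use \<phi>i in simp)
      then show "(LINT x|lebesgue. real (Suc m) * (u (x + (1 / real (Suc m)) *\<^sub>R e) - u x) * \<phi> x)
          \<le> L * norm e * (LINT x|lebesgue. \<phi> x)" by simp
    qed
    also have "L * norm e * (LINT x|lebesgue. \<phi> x) = set_lebesgue_integral lebesgue U (\<lambda>x. L * norm e * \<phi> x)"
    proof -
      have "L * norm e * \<phi> x = 0" if "x \<notin> U" for x using K(3)[of x] K(2) that by auto
      then have "set_lebesgue_integral lebesgue U (\<lambda>x. L * norm e * \<phi> x) = (LINT x|lebesgue. L * norm e * \<phi> x)"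
        by (rule set_lebesgue_integral_vanishing_outside)
      then show ?thesis by auto
    qed
    finally have "0 \<le> set_lebesgue_integral lebesgue U (\<lambda>x. L * norm e * \<phi> x)
        - set_lebesgue_integral lebesgue U (\<lambda>x. (G x \<bullet> e) * \<phi> x)" by simp
    also have "\<dots> = set_lebesgue_integral lebesgue U (\<lambda>x. L * norm e * \<phi> x - (G x \<bullet> e) * \<phi> x)"
      using C1c_mult_integrable(1)[OF U _ \<phi>(1)] li cl by (intro set_integral_diff(2)[symmetric]) auto
    finally show "0 \<le> set_lebesgue_integral lebesgue U (\<lambda>x. (L * norm e - G x \<bullet> e) * \<phi> x)"
      by (simp add: left_diff_distrib)
  qed
  obtain D :: "'a set" where D: "countable D" "\<And>X. open X \<Longrightarrow> X \<noteq> {} \<Longrightarrow> \<exists>d\<in>D. d \<in> X"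
    using countable_dense_exists by blast
  have "AE x in lebesgue_on U. \<forall>e\<in>D. 0 \<le> L * norm e - G x \<bullet> e"
    using D(1) dir by (subst AE_ball_countable) auto
  then show ?thesis
  proof eventually_elim
    case (elim x)
    show ?case
    proof (rule ccontr)
      assume "\<not> norm (G x) \<le> L"
      then have n: "L < norm (G x)" by simp
      then have "G x \<noteq> 0" using lipschitz_on_nonneg[OF u] by auto
      \<comment> \<open>If the bound fails at \<open>x\<close>, the direction \<open>G x\<close>
        itself violates the inequality. The violating directions form an open set, so some element
        of \<open>D\<close> violates it too.\<close>
      define X where "X = {e. L * norm e < G x \<bullet> e}"
      have "open X" unfolding X_def by (intro open_Collect_less continuous_intros)
      moreover have "G x \<in> X" using n \<open>G x \<noteq> 0\<close>
        by (simp add: X_def power2_norm_eq_inner[symmetric] power2_eq_square)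
      ultimately obtain e where "e \<in> D" "e \<in> X" using D(2)[of X] by blast
      then show False using elim by (force simp: X_def)
    qed
  qed
qed

section \<open>Linearity and uniqueness of weak gradients\<close>

lemma has_weak_gradient_lincomb:
  fixes u v :: "'a::euclidean_space \<Rightarrow> real"
  assumes U: "open U" and G: "has_weak_gradient U u G" and H: "has_weak_gradient U v H"
  shows "has_weak_gradient U (\<lambda>x. c * u x + v x) (\<lambda>x. c *\<^sub>R G x + H x)"
  unfolding has_weak_gradient_def
proof (intro conjI ballI)
  have l: "locally_integrable U u" "locally_integrable U G" "locally_integrable U v" "locally_integrable U H"
    using G H by (auto simp: has_weak_gradient_def)
  show "locally_integrable U (\<lambda>x. c * u x + v x)"
    using l unfolding locally_integrable_def
    by (intro allI impI set_integral_add(1) set_integrable_mult_right) auto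
  show "locally_integrable U (\<lambda>x. c *\<^sub>R G x + H x)"
    using l unfolding locally_integrable_def
    by (intro allI impI set_integral_add(1) set_integrable_scaleR_right) auto
  fix \<phi> :: "'a \<Rightarrow> real" and i :: 'a assume \<phi>: "\<phi> \<in> C1c U" and i: "i \<in> Basis"
  let ?d = "\<lambda>x. frechet_derivative \<phi> (at x) i"
  have "set_lebesgue_integral lebesgue U (\<lambda>x. (c * u x + v x) * ?d x)
      = set_lebesgue_integral lebesgue U (\<lambda>x. c * (u x * ?d x) + v x * ?d x)"
    by (simp add: algebra_simps)
  also have "\<dots> = c * set_lebesgue_integral lebesgue U (\<lambda>x. u x * ?d x)
      + set_lebesgue_integral lebesgue U (\<lambda>x. v x * ?d x)"
    using C1c_mult_integrable(2)[OF U l(1) \<phi>] C1c_mult_integrable(2)[OF U l(3) \<phi>]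
    by (subst set_integral_add(2)) auto
  also have "\<dots> = - (c * set_lebesgue_integral lebesgue U (\<lambda>x. (G x \<bullet> i) * \<phi> x)
      + set_lebesgue_integral lebesgue U (\<lambda>x. (H x \<bullet> i) * \<phi> x))"
    using G H \<phi> i by (simp add: has_weak_gradient_def)
  also have "c * set_lebesgue_integral lebesgue U (\<lambda>x. (G x \<bullet> i) * \<phi> x)
      + set_lebesgue_integral lebesgue U (\<lambda>x. (H x \<bullet> i) * \<phi> x)
     = set_lebesgue_integral lebesgue U (\<lambda>x. c * ((G x \<bullet> i) * \<phi> x) + (H x \<bullet> i) * \<phi> x)"
    using C1c_mult_integrable(1)[OF U weak_gradient_directional(1)[OF U G \<phi>] \<phi>]
      C1c_mult_integrable(1)[OF U weak_gradient_directional(1)[OF U H \<phi>] \<phi>]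
    by (subst set_integral_add(2)) auto
  also have "\<dots> = set_lebesgue_integral lebesgue U (\<lambda>x. ((c *\<^sub>R G x + H x) \<bullet> i) * \<phi> x)"
    by (simp add: algebra_simps inner_add_left)
  finally show "set_lebesgue_integral lebesgue U (\<lambda>x. (c * u x + v x) * ?d x)
     = - set_lebesgue_integral lebesgue U (\<lambda>x. ((c *\<^sub>R G x + H x) \<bullet> i) * \<phi> x)" .
qed

text \<open>The difference of two weak gradients is a weak gradient of the zero function, whose
  Lipschitz constant is 0.\<close>

lemma weak_gradient_unique:
  fixes u :: "'a::euclidean_space \<Rightarrow> real"
  assumes U: "open U" and G: "has_weak_gradient U u G" and H: "has_weak_gradient U u H"
  shows "AE x in lebesgue_on U. G x = H x"
proof -
  have "has_weak_gradient U (\<lambda>x. 0) (\<lambda>x. H x - G x)"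
    using has_weak_gradient_lincomb[OF U G H, of "-1"] by simp
  moreover have "0-lipschitz_on UNIV (\<lambda>x::'a. 0::real)" by (intro lipschitz_onI) auto
  ultimately have "AE x in lebesgue_on U. norm (H x - G x) \<le> 0"
    by (rule norm_weak_gradient_Lipschitz_le[OF U])
  then show ?thesis by eventually_elim simp
qed

lemma has_weak_gradient_weak_gradient:
  "has_weak_gradient U u G \<Longrightarrow> has_weak_gradient U u (weak_gradient U u)"
  unfolding weak_gradient_def by (rule someI[where P="has_weak_gradient U u"])

lemma has_weak_gradient_measurable:
  assumes "open U" "has_weak_gradient U u G"
  shows "G \<in> borel_measurable (lebesgue_on U)"
  using assms locally_integrable_measurable by (auto simp: has_weak_gradient_def)

section \<open>Essential suprema and the space \<open>W1inf0\<close>\<close>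

lemma Linf_norm_le:
  assumes "f \<in> borel_measurable (lebesgue_on U)" "AE x in lebesgue_on U. ereal (norm (f x)) \<le> c"
  shows "Linf_norm U f \<le> c"
  unfolding Linf_norm_def using assms by (intro esssup_I) auto

lemma norm_le_Linf_norm: "AE x in lebesgue_on U. ereal (norm (f x)) \<le> Linf_norm U f"
  unfolding Linf_norm_def by (rule esssup_AE)

text \<open>A negative essential supremum of a norm is possible only over a null set, and a nonempty
  open set is not null.\<close>

lemma Linf_norm_nonneg:
  assumes "open U" "U \<noteq> {}"
  shows "0 \<le> Linf_norm U f"
proof (rule ccontr)
  assume neg: "\<not> 0 \<le> Linf_norm U f"
  have "AE x in lebesgue_on U. False"
    using norm_le_Linf_norm[of f U]
  proof eventually_elim
    case (elim x)
    have "0 \<le> ereal (norm (f x))" by simp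
    also note elim
    finally show False using neg by simp
  qed
  then have "AE x in lebesgue. x \<notin> U" using assms(1) by (simp add: AE_restrict_space_iff)
  then have "negligible U" using assms(1) by (simp add: AE_iff_null_sets[symmetric] negligible_iff_null_sets)
  then show False using open_not_negligible assms by blast
qed

lemma Linf_norm_add_le:
  assumes "f \<in> borel_measurable (lebesgue_on U)" "g \<in> borel_measurable (lebesgue_on U)"
  shows "Linf_norm U (\<lambda>x. f x + g x) \<le> Linf_norm U f + Linf_norm U g"
proof (rule Linf_norm_le)
  show "AE x in lebesgue_on U. ereal (norm (f x + g x)) \<le> Linf_norm U f + Linf_norm U g"
    using norm_le_Linf_norm[of f U] norm_le_Linf_norm[of g U]
  proof eventually_elim
    case (elim x)
    have "ereal (norm (f x + g x)) \<le> ereal (norm (f x)) + ereal (norm (g x))"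
      by (simp add: norm_triangle_ineq)
    also have "\<dots> \<le> Linf_norm U f + Linf_norm U g" using elim by (rule add_mono)
    finally show ?case .
  qed
qed (use assms in auto)

text \<open>The chosen gradient of the sum need not be the sum of the chosen gradients, but
  uniqueness makes them agree almost everywhere. The second claim is the subadditivity of
  \<open>J\<close> on its domain.\<close>

lemma W1inf0_add:
  assumes U: "open U" and u: "u \<in> W1inf0 U" and v: "v \<in> W1inf0 U"
  shows "(\<lambda>x. u x + v x) \<in> W1inf0 U"
    and "Linf_norm U (weak_gradient U (\<lambda>x. u x + v x))
           \<le> Linf_norm U (weak_gradient U u) + Linf_norm U (weak_gradient U v)"
proof -
  let ?G = "weak_gradient U"
  have G: "has_weak_gradient U u (?G u)" "has_weak_gradient U v (?G v)"
    using u v has_weak_gradient_weak_gradient by (auto simp: W1inf0_def W1inf_def)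
  have m: "u \<in> borel_measurable (lebesgue_on U)" "v \<in> borel_measurable (lebesgue_on U)"
    using u v by (auto simp: W1inf0_def W1inf_def)
  have fin: "Linf_norm U u < \<infinity>" "Linf_norm U v < \<infinity>" "Linf_norm U (?G u) < \<infinity>" "Linf_norm U (?G v) < \<infinity>"
    using u v by (auto simp: W1inf0_def W1inf_def)
  have s: "has_weak_gradient U (\<lambda>x. u x + v x) (\<lambda>x. ?G u x + ?G v x)"
    using has_weak_gradient_lincomb[OF U G, of 1] by simp
  have ss: "has_weak_gradient U (\<lambda>x. u x + v x) (?G (\<lambda>x. u x + v x))"
    by (rule has_weak_gradient_weak_gradient[OF s])
  show le: "Linf_norm U (?G (\<lambda>x. u x + v x)) \<le> Linf_norm U (?G u) + Linf_norm U (?G v)"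
  proof (rule Linf_norm_le[OF has_weak_gradient_measurable[OF U ss]])
    show "AE x in lebesgue_on U. ereal (norm (?G (\<lambda>x. u x + v x) x)) \<le> Linf_norm U (?G u) + Linf_norm U (?G v)"
      using weak_gradient_unique[OF U ss s] norm_le_Linf_norm[of "\<lambda>x. ?G u x + ?G v x" U]
    proof eventually_elim
      case (elim x)
      have "ereal (norm (?G (\<lambda>x. u x + v x) x)) \<le> Linf_norm U (\<lambda>x. ?G u x + ?G v x)"
        using elim by simp
      also have "\<dots> \<le> Linf_norm U (?G u) + Linf_norm U (?G v)"
        by (rule Linf_norm_add_le[OF has_weak_gradient_measurable[OF U G(1)] has_weak_gradient_measurable[OF U G(2)]])
      finally show ?case .
    qed
  qed
  have "Linf_norm U (\<lambda>x. u x + v x) \<le> Linf_norm U u + Linf_norm U v"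
    by (intro Linf_norm_add_le m)
  then have "Linf_norm U (\<lambda>x. u x + v x) < \<infinity>" using fin by (auto elim!: le_less_trans)
  moreover have "Linf_norm U (?G (\<lambda>x. u x + v x)) < \<infinity>"
    using le fin by (auto elim!: le_less_trans)
  ultimately have "(\<lambda>x. u x + v x) \<in> W1inf U" using m s unfolding W1inf_def by auto
  moreover obtain u' v' where
    "continuous_on (closure U) u'" "\<forall>x\<in>frontier U. u' x = 0" "AE x in lebesgue_on U. u x = u' x"
    "continuous_on (closure U) v'" "\<forall>x\<in>frontier U. v' x = 0" "AE x in lebesgue_on U. v x = v' x"
    using u v unfolding W1inf0_def by auto
  then have "continuous_on (closure U) (\<lambda>x. u' x + v' x) \<and> (\<forall>x\<in>frontier U. u' x + v' x = 0)
     \<and> (AE x in lebesgue_on U. u x + v x = u' x + v' x)"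
    by (auto intro!: continuous_intros elim: eventually_elim2)
  ultimately show "(\<lambda>x. u x + v x) \<in> W1inf0 U"
    unfolding W1inf0_def by blast
qed

lemma Lipschitz_W1inf0:
  fixes u :: "'a::euclidean_space \<Rightarrow> real"
  assumes U: "open U" "bounded U" and u: "L-lipschitz_on UNIV u" and z: "\<And>x. x \<in> frontier U \<Longrightarrow> u x = 0"
  shows "u \<in> W1inf0 U" "Linf_norm U (weak_gradient U u) \<le> ereal L"
proof -
  have uc: "continuous_on UNIV u" using lipschitz_on_continuous_on[OF u] .
  have um: "u \<in> borel_measurable (lebesgue_on U)"
    by (rule measurable_restrict_space1[OF continuous_measurable_lebesgue[OF uc]])
  obtain G where "has_weak_gradient U u G" using Lipschitz_has_weak_gradient[OF U u] by blast
  then have G: "has_weak_gradient U u (weak_gradient U u)" by (rule has_weak_gradient_weak_gradient)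
  have "AE x in lebesgue_on U. ereal (norm (weak_gradient U u x)) \<le> ereal L"
    using norm_weak_gradient_Lipschitz_le[OF U(1) G u] by simp
  then show le: "Linf_norm U (weak_gradient U u) \<le> ereal L"
    by (rule Linf_norm_le[OF has_weak_gradient_measurable[OF U(1) G]])
  have "compact (closure U)" using U(2) by (simp add: compact_closure)
  then have "bounded (u ` closure U)"
    using compact_continuous_image[OF continuous_on_subset[OF uc]] compact_imp_bounded by blast
  then obtain B where B: "\<And>x. x \<in> closure U \<Longrightarrow> \<bar>u x\<bar> \<le> B" by (auto simp: bounded_iff)
  have "AE x in lebesgue_on U. ereal (norm (u x)) \<le> ereal B"
    using B closure_subset[of U] by (intro AE_I2) (auto simp: space_restrict_space)
  then have "Linf_norm U u \<le> ereal B" by (rule Linf_norm_le[OF um])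
  then have "u \<in> W1inf U" using um G le unfolding W1inf_def by (auto elim!: le_less_trans)
  then show "u \<in> W1inf0 U" using z continuous_on_subset[OF uc] unfolding W1inf0_def by auto
qed

lemma W1inf_subset_L2:
  assumes "open U" "bounded U" "u \<in> W1inf U"
  shows "u \<in> L2 U"
proof -
  obtain B where B: "Linf_norm U u \<le> ereal B"
    using assms(3) less_PInf_Ex_of_nat[of "Linf_norm U u"] by (auto simp: W1inf_def dest: less_imp_le)
  have "AE x in lebesgue_on U. \<bar>u x\<bar> \<le> B"
    using norm_le_Linf_norm[of u U]
  proof eventually_elim
    case (elim x)
    from order_trans[OF elim B] show ?case by simp
  qed
  then show ?thesis using assms by (intro L2_bounded) (auto simp: W1inf_def)
qed

text \<open>Testing the subgradient inequality with \<open>u + v\<close> and using subadditivity of \<open>J\<close>.\<close>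

lemma subdifferential_J_le:
  assumes U: "open U" "bounded U" and u: "u \<in> W1inf0 U" and v: "v \<in> W1inf0 U"
    and p: "p \<in> subdifferential U (J U) u"
    and fin: "\<bar>Linf_norm U (weak_gradient U u)\<bar> \<noteq> \<infinity>"
  shows "ereal (L2_inner U p v) \<le> Linf_norm U (weak_gradient U v)"
proof -
  note s = W1inf0_add[OF U(1) u v]
  have "(\<lambda>x. u x + v x) \<in> L2 U" using W1inf_subset_L2[OF U] s(1) by (simp add: W1inf0_def)
  moreover have "\<forall>w\<in>L2 U. J U u + ereal (L2_inner U p (\<lambda>x. w x - u x)) \<le> J U w"
    using p by (simp add: subdifferential_def)
  ultimately have "J U u + ereal (L2_inner U p (\<lambda>x. (u x + v x) - u x)) \<le> J U (\<lambda>x. u x + v x)"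
    by (rule bspec[rotated])
  then have "Linf_norm U (weak_gradient U u) + ereal (L2_inner U p v)
      \<le> Linf_norm U (weak_gradient U u) + Linf_norm U (weak_gradient U v)"
    using s u unfolding J_def by (auto intro: order_trans)
  \<comment> \<open>Only a finite \<open>J(u)\<close> may be cancelled in the extended
    reals.\<close>
  then show ?thesis using fin by (auto simp: ereal_add_le_add_iff)
qed

section \<open>Gradient flows and minimizers\<close>

lemma L2_inner_cong_AE:
  assumes "f \<in> borel_measurable (lebesgue_on U)" "f' \<in> borel_measurable (lebesgue_on U)"
    "g \<in> borel_measurable (lebesgue_on U)" "AE x in lebesgue_on U. f x = f' x"
  shows "L2_inner U f g = L2_inner U f' g"
  unfolding L2_inner_def using assms(4) by (intro integral_cong_AE) (use assms in \<open>auto elim: eventually_mono\<close>)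

text \<open>Expanding the square around \<open>u\<close> gives a quantitative gap: the energy of
  \<open>w\<close> exceeds that of \<open>u\<close> by at least half the squared distance.
  Minimality and uniqueness both follow. \<open>L\<close> enters merely as an upper bound for
  \<open>J(u)\<close>, but \<open>dual\<close> with \<open>v = u\<close> and \<open>attained\<close>
  together force equality.\<close>

lemma minimizers_criterion:
  assumes U: "open U" "U \<noteq> {}" "bounded U" and f: "f \<in> L2 U" and u: "u \<in> W1inf0 U" and t: "t > 0"
    and uL: "Linf_norm U (weak_gradient U u) \<le> ereal L"
    and dual: "\<And>v C. v \<in> W1inf0 U \<Longrightarrow> Linf_norm U (weak_gradient U v) \<le> ereal C \<Longrightarrow>
                 L2_inner U (\<lambda>x. f x - u x) v \<le> t * C"
    and attained: "t * L \<le> L2_inner U (\<lambda>x. f x - u x) u"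
  shows "u \<in> minimizers U f t" "\<forall>v\<in>minimizers U f t. AE x in lebesgue_on U. v x = u x"
proof -
  have W: "w \<in> L2 U" if "w \<in> W1inf0 U" for w
    using that W1inf_subset_L2[OF U(1,3)] by (auto simp: W1inf0_def)
  have uu: "u \<in> L2 U" by (rule W[OF u])
  have real: "\<exists>N. Linf_norm U (weak_gradient U w) = ereal N" if "w \<in> W1inf0 U" for w
  proof -
    have "Linf_norm U (weak_gradient U w) < \<infinity>" using that by (simp add: W1inf0_def W1inf_def)
    then show ?thesis using Linf_norm_nonneg[OF U(1,2), of "weak_gradient U w"]
      by (cases "Linf_norm U (weak_gradient U w)") auto
  qed
  have key: "energy U f t u + ereal (1/2 * (L2_norm U (\<lambda>x. w x - u x))\<^sup>2) \<le> energy U f t w"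
    if w: "w \<in> W1inf0 U" for w
  proof -
    obtain N where N: "Linf_norm U (weak_gradient U w) = ereal N" using real[OF w] by blast
    obtain N0 where N0: "Linf_norm U (weak_gradient U u) = ereal N0" using real[OF u] by blast
    have ww: "w \<in> L2 U" by (rule W[OF w])
    let ?a = "\<lambda>x. w x - u x" and ?b = "\<lambda>x. f x - u x"
    have ab: "?a \<in> L2 U" "?b \<in> L2 U" using ww uu f by (auto intro: L2_diff)
    \<comment> \<open>The decomposition \<open>w - f = (w - u) - (f - u)\<close> isolates the mixed
      term, which \<open>dual\<close> and \<open>attained\<close> control.\<close>
    have "(L2_norm U (\<lambda>x. w x - f x))\<^sup>2 = (L2_norm U (\<lambda>x. ?a x - ?b x))\<^sup>2" by simp
    also have "\<dots> = (L2_norm U ?a)\<^sup>2 - 2 * L2_inner U ?a ?b + (L2_norm U ?b)\<^sup>2"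
      by (rule L2_norm_diff_sq[OF ab])
    also have "L2_inner U ?a ?b = L2_inner U ?b w - L2_inner U ?b u"
      using L2_inner_diff_right[OF ww uu ab(2)] by (simp add: L2_inner_commute)
    also have "L2_norm U ?b = L2_norm U (\<lambda>x. u x - f x)"
      by (simp add: L2_norm_def power2_commute)
    finally have *: "(L2_norm U (\<lambda>x. w x - f x))\<^sup>2 = (L2_norm U ?a)\<^sup>2
       - 2 * (L2_inner U ?b w - L2_inner U ?b u) + (L2_norm U (\<lambda>x. u x - f x))\<^sup>2" .
    have "L2_inner U ?b w \<le> t * N" using dual[OF w] N by simp
    moreover have "t * N0 \<le> L2_inner U ?b u"
      using attained uL N0 t by (auto intro: order_trans[OF mult_left_mono])
    ultimately have "1/2 * (L2_norm U (\<lambda>x. u x - f x))\<^sup>2 + t * N0 + 1/2 * (L2_norm U ?a)\<^sup>2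
        \<le> 1/2 * (L2_norm U (\<lambda>x. w x - f x))\<^sup>2 + t * N"
      unfolding * by (simp add: algebra_simps)
    then show ?thesis by (simp add: energy_def N N0)
  qed
  show "u \<in> minimizers U f t" unfolding minimizers_def
  proof (intro CollectI conjI ballI u)
    fix w assume w: "w \<in> W1inf0 U"
    have "energy U f t u \<le> energy U f t u + ereal (1/2 * (L2_norm U (\<lambda>x. w x - u x))\<^sup>2)"
      by (rule add_increasing2) auto
    then show "energy U f t u \<le> energy U f t w" using key[OF w] by (rule order_trans)
  qed
  show "\<forall>v\<in>minimizers U f t. AE x in lebesgue_on U. v x = u x"
  proof
    fix v assume v: "v \<in> minimizers U f t"
    then have vW: "v \<in> W1inf0 U" and le: "energy U f t v \<le> energy U f t u"
      using u by (auto simp: minimizers_def)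
    obtain N0 where N0: "Linf_norm U (weak_gradient U u) = ereal N0" using real[OF u] by blast
    have "energy U f t u + ereal (1/2 * (L2_norm U (\<lambda>x. v x - u x))\<^sup>2) \<le> energy U f t u"
      using key[OF vW] le by (rule order_trans)
    then have "L2_norm U (\<lambda>x. v x - u x) = 0" by (simp add: energy_def N0)
    then have "AE x in lebesgue_on U. v x - u x = 0"
      using L2_norm_eq_0_iff[OF L2_diff[OF W[OF vW] uu]] by blast
    then show "AE x in lebesgue_on U. v x = u x" by eventually_elim simp
  qed
qed

section \<open>Curves in \<open>L2\<close> paired with a fixed function\<close>

lemma L2_inner_diff_le:
  assumes "f \<in> L2 U" "g \<in> L2 U" "v \<in> L2 U"
  shows "\<bar>L2_inner U f v - L2_inner U g v\<bar> \<le> L2_norm U (\<lambda>x. f x - g x) * L2_norm U v"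
  using L2_Cauchy_Schwarz[OF L2_diff[OF assms(1,2)] assms(3)] L2_inner_diff_left[OF assms] by simp

lemma L2_continuous_on_inner:
  assumes c: "L2_continuous_on U T u" and u: "\<And>t. t \<in> T \<Longrightarrow> u t \<in> L2 U" and v: "v \<in> L2 U" and t: "t \<in> T"
  shows "((\<lambda>s. L2_inner U (u s) v) \<longlongrightarrow> L2_inner U (u t) v) (at t within T)"
proof (rule LIM_zero_cancel, rule Lim_null_comparison)
  show "\<forall>\<^sub>F s in at t within T. norm (L2_inner U (u s) v - L2_inner U (u t) v)
     \<le> L2_norm U (\<lambda>x. u s x - u t x) * L2_norm U v"
    unfolding eventually_at_filter using L2_inner_diff_le[OF u u[OF t] v] by (intro always_eventually) auto
  have "((\<lambda>s. L2_norm U (\<lambda>x. u s x - u t x)) \<longlongrightarrow> 0) (at t within T)"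
    using c t by (simp add: L2_continuous_on_def)
  then show "((\<lambda>s. L2_norm U (\<lambda>x. u s x - u t x) * L2_norm U v) \<longlongrightarrow> 0) (at t within T)"
    by (rule tendsto_mult_left_zero)
qed

lemma L2_has_derivative_inner:
  assumes d: "L2_has_derivative U u w t" and u: "\<And>s. 0 \<le> s \<Longrightarrow> u s \<in> L2 U" and v: "v \<in> L2 U" and t: "0 < t"
  shows "((\<lambda>s. L2_inner U (u s) v) has_real_derivative L2_inner U w v) (at t)"
  unfolding has_field_derivative_iff
proof (rule LIM_zero_cancel, rule Lim_null_comparison)
  have w: "w \<in> L2 U" using d by (simp add: L2_has_derivative_def)
  \<comment> \<open>\<open>u s\<close> is known to lie in \<open>L2\<close> for
    \<open>s \<ge> 0\<close> only, so the two-sided limit is taken through positive times near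
    \<open>t\<close>.\<close>
  have "\<forall>\<^sub>F s in at t. s > 0" by (rule order_tendstoD(1)[OF tendsto_ident_at t])
  then show "\<forall>\<^sub>F s in at t. norm ((L2_inner U (u s) v - L2_inner U (u t) v) / (s - t) - L2_inner U w v)
     \<le> L2_norm U (\<lambda>x. (u s x - u t x) / (s - t) - w x) * L2_norm U v"
  proof eventually_elim
    case (elim s)
    have ul: "u s \<in> L2 U" "u t \<in> L2 U" using u elim t by auto
    let ?q = "\<lambda>x. (1 / (s - t)) * (u s x - u t x)"
    have q: "?q \<in> L2 U" using ul by (intro L2_cmult L2_diff)
    have "L2_inner U ?q v = (L2_inner U (u s) v - L2_inner U (u t) v) / (s - t)"
      by (simp only: L2_inner_cmult_left L2_inner_diff_left[OF ul v]) simp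
    then show ?case using L2_inner_diff_le[OF q w v] by simp
  qed
  have "((\<lambda>s. L2_norm U (\<lambda>x. (u s x - u t x) / (s - t) - w x)) \<longlongrightarrow> 0) (at t)"
    using d by (simp add: L2_has_derivative_def)
  then show "((\<lambda>s. L2_norm U (\<lambda>x. (u s x - u t x) / (s - t) - w x) * L2_norm U v) \<longlongrightarrow> 0) (at t)"
    by (rule tendsto_mult_left_zero)
qed

text \<open>Cauchy-Schwarz turns absolute continuity in \<open>L2\<close> into the scalar increment
  bound that the lemma on increments takes as its hypothesis, with \<open>K\<close> the norm of
  \<open>v\<close>.\<close>

lemma L2_abs_continuous_inner_increment:
  assumes ac: "L2_abs_continuous_on U a b u" and u: "\<And>s. a \<le> s \<Longrightarrow> u s \<in> L2 U" and v: "v \<in> L2 U"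
  obtains m where "set_integrable lebesgue {a..b} m"
    "\<And>s t. a \<le> s \<Longrightarrow> s \<le> t \<Longrightarrow> t \<le> b \<Longrightarrow>
       \<bar>L2_inner U (u t) v - L2_inner U (u s) v\<bar> \<le> L2_norm U v * set_lebesgue_integral lebesgue {s..t} m"
proof -
  obtain m where m: "set_integrable lebesgue {a..b} m"
    "\<And>s t. a \<le> s \<Longrightarrow> s \<le> t \<Longrightarrow> t \<le> b \<Longrightarrow>
        L2_norm U (\<lambda>x. u t x - u s x) \<le> set_lebesgue_integral lebesgue {s..t} m"
    using ac unfolding L2_abs_continuous_on_def by blast
  show thesis
  proof (rule that[OF m(1)])
    fix s t assume st: "a \<le> s" "s \<le> t" "t \<le> b"
    have "\<bar>L2_inner U (u t) v - L2_inner U (u s) v\<bar> \<le> L2_norm U (\<lambda>x. u t x - u s x) * L2_norm U v"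
      using st by (intro L2_inner_diff_le u v) auto
    also have "\<dots> \<le> set_lebesgue_integral lebesgue {s..t} m * L2_norm U v"
      using m(2)[OF st] by (rule mult_right_mono[OF _ L2_norm_nonneg])
    finally show "\<bar>L2_inner U (u t) v - L2_inner U (u s) v\<bar> \<le> L2_norm U v * set_lebesgue_integral lebesgue {s..t} m"
      by (simp add: mult.commute)
  qed
qed

lemma gradient_flow_dual_bound:
  fixes u :: "real \<Rightarrow> 'a::euclidean_space \<Rightarrow> real"
  assumes U: "open U" "U \<noteq> {}" "bounded U" and gf: "gradient_flow_solution U (J U) f u" and f: "f \<in> L2 U"
    and uW: "\<And>s. 0 < s \<Longrightarrow> u s \<in> W1inf0 U"
    and v: "v \<in> W1inf0 U" "Linf_norm U (weak_gradient U v) \<le> ereal C" and t: "0 < t"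
  shows "L2_inner U (\<lambda>x. f x - u t x) v \<le> t * C"
proof -
  have vl: "v \<in> L2 U" using v(1) W1inf_subset_L2[OF U(1,3)] by (simp add: W1inf0_def)
  have ul: "u s \<in> L2 U" if "0 \<le> s" for s using gf that by (simp add: gradient_flow_solution_def)
  \<comment> \<open>With this sign the derivative is the pairing of the subgradient
    \<open>- u'(s)\<close> with \<open>v\<close>, hence at most \<open>C\<close>.\<close>
  define \<phi> where "\<phi> s = - L2_inner U (u s) v" for s
  have inc: "\<phi> t - \<phi> a \<le> C * (t - a)" if a: "0 < a" "a \<le> t" for a
  proof -
    have "L2_abs_continuous_on U a t u" using gf a by (simp add: gradient_flow_solution_def)
    then obtain m where m: "set_integrable lebesgue {a..t} m"
      "\<And>s s'. a \<le> s \<Longrightarrow> s \<le> s' \<Longrightarrow> s' \<le> t \<Longrightarrow>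
       \<bar>L2_inner U (u s') v - L2_inner U (u s) v\<bar> \<le> L2_norm U v * set_lebesgue_integral lebesgue {s..s'} m"
      using a by (rule_tac L2_abs_continuous_inner_increment[of U a t u v]) (auto intro: ul vl)
    show ?thesis
    proof (rule derivative_le_AE_imp_increment_le[OF a(2) m(1)])
      show "\<phi> s' - \<phi> s \<le> L2_norm U v * set_lebesgue_integral lebesgue {s..s'} m"
        if "a \<le> s" "s \<le> s'" "s' \<le> t" for s s'
        using m(2)[OF that] by (simp add: \<phi>_def)
      have "AE s in lebesgue. 0 < s \<longrightarrow>
          (\<exists>w. L2_has_derivative U u w s \<and> (\<lambda>x. - w x) \<in> subdifferential U (J U) (u s))"
        using gf by (simp add: gradient_flow_solution_def)
      then show "AE s in lebesgue. a < s \<and> s < t \<longrightarrow> (\<exists>D\<le>C. (\<phi> has_real_derivative D) (at s))"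
      proof eventually_elim
        case (elim s)
        show ?case
        proof
          assume s: "a < s \<and> s < t"
          then have s0: "0 < s" using a by simp
          obtain w where w: "L2_has_derivative U u w s" "(\<lambda>x. - w x) \<in> subdifferential U (J U) (u s)"
            using elim s0 by blast
          have "\<bar>Linf_norm U (weak_gradient U (u s))\<bar> \<noteq> \<infinity>"
            using uW[OF s0] Linf_norm_nonneg[OF U(1,2), of "weak_gradient U (u s)"]
            by (auto simp: W1inf0_def W1inf_def)
          from subdifferential_J_le[OF U(1,3) uW[OF s0] v(1) w(2) this]
          have "ereal (L2_inner U (\<lambda>x. - w x) v) \<le> ereal C" using v(2) by (rule order_trans)
          then have "- L2_inner U w v \<le> C" using L2_inner_cmult_left[of U "-1" w v] by simp
          moreover have "(\<phi> has_real_derivative - L2_inner U w v) (at s)" unfolding \<phi>_def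
            by (intro DERIV_minus L2_has_derivative_inner[OF w(1) ul vl s0])
          ultimately show "\<exists>D\<le>C. (\<phi> has_real_derivative D) (at s)" by blast
        qed
      qed
    qed
  qed
  \<comment> \<open>Continuity in \<open>L2\<close> up to time 0 allows the left endpoint to tend to
    0, which recovers the datum \<open>f\<close>.\<close>
  have "L2_continuous_on U {0..} u" using gf by (simp add: gradient_flow_solution_def)
  then have "((\<lambda>s. L2_inner U (u s) v) \<longlongrightarrow> L2_inner U (u 0) v) (at 0 within {0..})"
    by (rule L2_continuous_on_inner) (auto intro: ul vl)
  then have "((\<lambda>s. L2_inner U (u s) v) \<longlongrightarrow> L2_inner U (u 0) v) (at_right 0)"
    by (rule tendsto_within_subset) auto
  moreover have "L2_inner U (u 0) v = L2_inner U f v"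
    using ul[of 0] f vl gf by (intro L2_inner_cong_AE) (auto simp: L2_def gradient_flow_solution_def)
  ultimately have lim: "((\<lambda>s. \<phi> s + C * (t - s)) \<longlongrightarrow> - L2_inner U f v + C * (t - 0)) (at_right 0)"
    unfolding \<phi>_def by (intro tendsto_intros) simp
  have "\<forall>\<^sub>F s in at_right 0. \<phi> t \<le> \<phi> s + C * (t - s)"
    unfolding eventually_at_right_field using inc t by (intro exI[of _ t]) (auto simp: algebra_simps)
  then have "\<phi> t \<le> - L2_inner U f v + C * (t - 0)"
    by (intro tendsto_lowerbound[OF lim]) auto
  then show ?thesis using t
    by (simp add: \<phi>_def L2_inner_diff_left[OF f ul vl] mult.commute)
qed

section \<open>The explicit flow\<close>

lemma bdist_Lipschitz: "1-lipschitz_on S (bdist U)"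
  by (intro lipschitz_onI) (auto simp: bdist_def dist_real_def infdist_triangle_abs)

lemma bdist_nonneg: "0 \<le> bdist U x"
  by (simp add: bdist_def infdist_nonneg)

lemma continuous_on_bdist: "continuous_on S (bdist U)"
  using lipschitz_on_continuous_on[OF bdist_Lipschitz] .

lemma bdist_frontier: "x \<in> frontier U \<Longrightarrow> bdist U x = 0"
  by (simp add: bdist_def)

lemma bdist_le_inradius:
  assumes "bounded U" "x \<in> U"
  shows "bdist U x \<le> inradius U"
proof -
  have "bounded (bdist U ` closure U)"
    using assms(1) by (intro compact_imp_bounded compact_continuous_image continuous_on_bdist) (simp add: compact_closure)
  then have "bdd_above (bdist U ` U)"
    by (rule bounded_imp_bdd_above[OF bounded_subset]) (use closure_subset in blast)
  then show ?thesis unfolding inradius_def using assms(2) by (intro cSUP_upper)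
qed

lemma inradius_nonneg: "bounded U \<Longrightarrow> U \<noteq> {} \<Longrightarrow> 0 \<le> inradius U"
  using order_trans[OF bdist_nonneg bdist_le_inradius] by (metis ex_in_conv)

lemma I2_eq:
  fixes U :: "'a::euclidean_space set"
  assumes "open U"
  shows "I2 U \<gamma> = (LINT x|lebesgue_on U. indicat_real {x. bdist U x < inradius U * \<gamma>} x * (bdist U x)\<^sup>2)"
proof -
  have "I2 U \<gamma> = (LINT x|lebesgue. indicat_real U x *\<^sub>R (indicat_real {x. bdist U x < inradius U * \<gamma>} x * (bdist U x)\<^sup>2))"
    unfolding I2_def set_lebesgue_integral_def inner_parallel_def
    by (rule arg_cong[where f="integral\<^sup>L lebesgue"]) (auto simp: fun_eq_iff indicator_def)
  then show ?thesis using assms by (simp add: integral_restrict_space)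
qed

lemma I2_nonneg: "0 \<le> I2 U \<gamma>"
  unfolding I2_def set_lebesgue_integral_def by (intro Bochner_Integration.integral_nonneg) auto

lemma I2_zero: "I2 U 0 = 0"
proof -
  have "U - inner_parallel U 0 = {}" by (auto simp: inner_parallel_def bdist_nonneg)
  then show ?thesis unfolding I2_def mult_zero_right by (simp only: set_lebesgue_integral_def) simp
qed

text \<open>\<open>I2\<close> vanishes at 0, so the requirement \<open>I2 U (g t) \<noteq> 0\<close>
  keeps \<open>g t\<close> away from 0; both signs are then known.\<close>

lemma ode_solution_pos:
  assumes "ode_solution U T g" "0 < t" "t \<le> T"
  shows "0 < g t" "0 < I2 U (g t)"
proof -
  have "I2 U (g t) \<noteq> 0" "g t \<in> {0..1}"
    using assms by (auto simp: ode_solution_def image_subset_iff)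
  then show "0 < g t" "0 < I2 U (g t)" using I2_nonneg[of U "g t"] I2_zero[of U]
    by (auto simp: order_less_le)
qed

lemma ode_solution_deriv:
  assumes "ode_solution U T g" "0 < t" "t < T"
  shows "(g has_real_derivative (g t)\<^sup>2 / I2 U (g t)) (at t)"
proof -
  have "(g has_real_derivative (g t)\<^sup>2 / I2 U (g t)) (at t within {0..T})"
    using assms by (simp add: ode_solution_def)
  moreover have "at t within {0..T} = at t" using assms by (intro at_within_interior) simp
  ultimately show ?thesis by simp
qed

lemma ode_solution_mono:
  assumes g: "ode_solution U T g" and st: "0 < s" "s < t" "t \<le> T"
  shows "g s < g t"
proof (rule DERIV_pos_imp_increasing_open[OF st(2)])
  show "\<exists>y. (g has_real_derivative y) (at x) \<and> 0 < y" if "s < x" "x < t" for x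
    using ode_solution_deriv[OF g, of x] ode_solution_pos[OF g, of x] st that
    by (intro exI[of _ "(g x)\<^sup>2 / I2 U (g x)"]) auto
  have "continuous_on {0..T} g" using g by (simp add: ode_solution_def)
  then show "continuous_on {s..t} g" by (rule continuous_on_subset) (use st in auto)
qed

text \<open>The factor of the distance function in either branch of \<open>flow\<close>, before
  truncation by the inradius. As the distance is 1-Lipschitz, it is a Lipschitz constant of the
  flow, and it becomes 0 at extinction.\<close>

definition flow_Lipschitz_const :: "'a::euclidean_space set \<Rightarrow> real \<Rightarrow> (real \<Rightarrow> real) \<Rightarrow> real \<Rightarrow> real" where
  "flow_Lipschitz_const U T g t = (if t < T then 1 / g t
     else 1 / (L2_norm U (bdist U))\<^sup>2 * max ((L2_norm U (bdist U))\<^sup>2 + T - t) 0)"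

lemma flow_eq:
  assumes "ode_solution U T g" "0 < t"
  shows "flow U T g t x = (if t < T then min (1 / g t * bdist U x) (inradius U)
           else flow_Lipschitz_const U T g t * bdist U x)"
  using ode_solution_pos[OF assms(1,2)] assms(2) by (auto simp: flow_def flow_Lipschitz_const_def)

lemma flow_Lipschitz_const_nonneg:
  assumes "ode_solution U T g" "0 < t"
  shows "0 \<le> flow_Lipschitz_const U T g t"
  using ode_solution_pos(1)[OF assms] by (auto simp: flow_Lipschitz_const_def)

lemma flow_Lipschitz:
  assumes g: "ode_solution U T g" and t: "0 < t"
  shows "(flow_Lipschitz_const U T g t)-lipschitz_on UNIV (flow U T g t)"
proof (rule lipschitz_onI)
  fix x y
  let ?L = "flow_Lipschitz_const U T g t"
  have L0: "0 \<le> ?L" by (rule flow_Lipschitz_const_nonneg[OF g t])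
  have "\<bar>bdist U x - bdist U y\<bar> \<le> dist x y" by (simp add: bdist_def infdist_triangle_abs)
  from mult_left_mono[OF this L0] have *: "\<bar>?L * bdist U x - ?L * bdist U y\<bar> \<le> ?L * dist x y"
    by (simp add: right_diff_distrib[symmetric] abs_mult L0)
  show "dist (flow U T g t x) (flow U T g t y) \<le> ?L * dist x y"
  proof (cases "t < T")
    case True
    then have "flow U T g t z = min (?L * bdist U z) (inradius U)" for z
      using flow_eq[OF g t] by (simp add: flow_Lipschitz_const_def)
    then show ?thesis using * by (auto simp: dist_real_def min_def)
  next
    case False
    then show ?thesis using * flow_eq[OF g t] by (simp add: dist_real_def)
  qed
qed (rule flow_Lipschitz_const_nonneg[OF g t])

lemma flow_W1inf0:
  assumes U: "open U" "U \<noteq> {}" "bounded U" and g: "ode_solution U T g" and t: "0 < t"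
  shows "flow U T g t \<in> W1inf0 U"
    "Linf_norm U (weak_gradient U (flow U T g t)) \<le> ereal (flow_Lipschitz_const U T g t)"
proof -
  have "flow U T g t x = 0" if "x \<in> frontier U" for x
    using inradius_nonneg[OF U(3,2)] by (simp add: flow_eq[OF g t] bdist_frontier[OF that])
  then show "flow U T g t \<in> W1inf0 U"
    "Linf_norm U (weak_gradient U (flow U T g t)) \<le> ereal (flow_Lipschitz_const U T g t)"
    using Lipschitz_W1inf0[OF U(1,3) flow_Lipschitz[OF g t]] by auto
qed

lemma continuous_L2:
  fixes f :: "'a::euclidean_space \<Rightarrow> real"
  assumes U: "open U" "bounded U" and f: "continuous_on UNIV f"
  shows "f \<in> L2 U"
proof -
  have "bounded (f ` closure U)"
    using U(2) continuous_on_subset[OF f]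
    by (intro compact_imp_bounded compact_continuous_image) (auto simp: compact_closure)
  then obtain B where B: "\<And>x. x \<in> closure U \<Longrightarrow> \<bar>f x\<bar> \<le> B" by (auto simp: bounded_iff)
  show ?thesis
  proof (rule L2_bounded)
    show "f \<in> borel_measurable (lebesgue_on U)"
      by (rule measurable_restrict_space1[OF continuous_measurable_lebesgue[OF f]])
    show "AE x in lebesgue_on U. \<bar>f x\<bar> \<le> B"
      using B closure_subset[of U] by (intro AE_I2) (auto simp: space_restrict_space)
  qed (use U in auto)
qed

text \<open>Where \<open>bdist U x < inradius U * g s\<close>, the truncation is inactive at time
  \<open>s\<close>, and also at \<open>t\<close> because \<open>g\<close> increases; there the flow
  drops by exactly \<open>(1 / g s - 1 / g t) * bdist U x\<close>. Elsewhere it does not increase,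
  and that contribution is discarded.\<close>

lemma flow_inner_bdist_increment:
  fixes U :: "'a::euclidean_space set"
  assumes U: "open U" "U \<noteq> {}" "bounded U" and g: "ode_solution U T g"
    and st: "0 < s" "s < t" "t < T"
  shows "(1 / g s - 1 / g t) * I2 U (g s)
    \<le> L2_inner U (flow U T g s) (bdist U) - L2_inner U (flow U T g t) (bdist U)"
proof -
  have gs: "0 < g s" "g s < g t" using ode_solution_pos[OF g, of s] ode_solution_mono[OF g st(1,2)] st by auto
  have L: "flow U T g s \<in> L2 U" "flow U T g t \<in> L2 U" "bdist U \<in> L2 U"
    using st by (auto intro!: continuous_L2[OF U(1,3)] lipschitz_on_continuous_on[OF flow_Lipschitz[OF g]] continuous_on_bdist)
  define A where "A = {x. bdist U x < inradius U * g s}"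
  have "open A" unfolding A_def by (intro open_Collect_less continuous_on_bdist continuous_on_const)
  then have A: "indicat_real A \<in> borel_measurable (lebesgue_on U)"
    by (intro measurable_restrict_space1 borel_measurable_indicator) auto
  have int: "integrable (lebesgue_on U) (\<lambda>x. (1 / g s - 1 / g t) * (indicat_real A x * (bdist U x)\<^sup>2))"
  proof (rule Bochner_Integration.integrable_bound[of _ "\<lambda>x. (1 / g s - 1 / g t) * (bdist U x)\<^sup>2"])
    show "(\<lambda>x. (1 / g s - 1 / g t) * (indicat_real A x * (bdist U x)\<^sup>2)) \<in> borel_measurable (lebesgue_on U)"
      using A L(3) by (intro borel_measurable_times borel_measurable_const borel_measurable_power) (auto simp: L2_def)
  qed (use L(3) in \<open>auto simp: L2_def indicator_def\<close>)
  have "(1 / g s - 1 / g t) * I2 U (g s) = (LINT x|lebesgue_on U. (1 / g s - 1 / g t) * (indicat_real A x * (bdist U x)\<^sup>2))"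
    by (simp add: I2_eq[OF U(1)] A_def)
  also have "\<dots> \<le> (LINT x|lebesgue_on U. (flow U T g s x - flow U T g t x) * bdist U x)"
  proof (rule integral_mono[OF int L2_mult_integrable[OF L2_diff[OF L(1,2)] L(3)]])
    fix x
    have d0: "0 \<le> bdist U x" by (rule bdist_nonneg)
    have fl: "flow U T g s x = min (1 / g s * bdist U x) (inradius U)" "flow U T g t x = min (1 / g t * bdist U x) (inradius U)"
      using flow_eq[OF g] st by auto
    have le: "1 / g t * bdist U x \<le> 1 / g s * bdist U x"
      using gs d0 by (intro mult_right_mono) (auto simp: frac_le)
    have "(1 / g s - 1 / g t) * indicat_real A x * bdist U x \<le> flow U T g s x - flow U T g t x"
    proof (cases "x \<in> A")
      case True
      then have "1 / g s * bdist U x \<le> inradius U" using gs by (simp add: A_def field_simps)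
      then show ?thesis using True unfolding fl by (simp add: left_diff_distrib min_def)
    next
      case False
      then show ?thesis unfolding fl using le by (simp add: min_def)
    qed
    from mult_right_mono[OF this d0]
    show "(1 / g s - 1 / g t) * (indicat_real A x * (bdist U x)\<^sup>2) \<le> (flow U T g s x - flow U T g t x) * bdist U x"
      by (simp add: power2_eq_square mult.assoc)
  qed
  also have "\<dots> = L2_inner U (flow U T g s) (bdist U) - L2_inner U (flow U T g t) (bdist U)"
    using L2_inner_diff_left[OF L] by (simp add: L2_inner_def)
  finally show ?thesis .
qed

text \<open>The differential equation for \<open>g\<close> says precisely that \<open>\<langle>- u'(t), d\<rangle> = 1\<close>.\<close>

lemma flow_inner_bdist_derivative:
  fixes U :: "'a::euclidean_space set"
  assumes U: "open U" "U \<noteq> {}" "bounded U" and g: "ode_solution U T g" and t: "0 < t" "t < T"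
    and D: "((\<lambda>s. L2_inner U (flow U T g s) (bdist U)) has_real_derivative D) (at t)"
  shows "D \<le> -1"
proof -
  let ?\<psi> = "\<lambda>s. L2_inner U (flow U T g s) (bdist U)"
  have gt: "0 < g t" "0 < I2 U (g t)" using ode_solution_pos[OF g] t by auto
  have "((\<lambda>s. 1 / g s) has_real_derivative - (1 / I2 U (g t))) (at t)"
    using ode_solution_deriv[OF g t] gt by (auto intro!: derivative_eq_intros simp: power2_eq_square field_simps)
  \<comment> \<open>Only quotients from the right are compared: the increment estimate contains
    \<open>I2\<close> at the earlier of the two times, which is then the fixed time
    \<open>t\<close>.\<close>
  then have "((\<lambda>s. (1 / g s - 1 / g t) / (s - t)) \<longlongrightarrow> - (1 / I2 U (g t))) (at_right t)"
    unfolding has_field_derivative_iff by (rule tendsto_within_subset) auto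
  then have "((\<lambda>s. (1 / g s - 1 / g t) / (s - t) * I2 U (g t)) \<longlongrightarrow> - (1 / I2 U (g t)) * I2 U (g t)) (at_right t)"
    by (intro tendsto_intros)
  then have 1: "((\<lambda>s. (1 / g s - 1 / g t) / (s - t) * I2 U (g t)) \<longlongrightarrow> -1) (at_right t)"
    using gt by simp
  have 2: "((\<lambda>s. (?\<psi> s - ?\<psi> t) / (s - t)) \<longlongrightarrow> D) (at_right t)"
    using D unfolding has_field_derivative_iff by (rule tendsto_within_subset) auto
  show ?thesis
  proof (rule tendsto_le[OF _ 1 2])
    show "\<forall>\<^sub>F s in at_right t. (?\<psi> s - ?\<psi> t) / (s - t) \<le> (1 / g s - 1 / g t) / (s - t) * I2 U (g t)"
      unfolding eventually_at_right_field
    proof (intro exI[of _ T] conjI allI impI t(2))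
      fix s assume s: "t < s" "s < T"
      have "?\<psi> s - ?\<psi> t \<le> (1 / g s - 1 / g t) * I2 U (g t)"
        using flow_inner_bdist_increment[OF U g t(1) s] by (simp add: algebra_simps)
      from divide_right_mono[OF this, of "s - t"] show "(?\<psi> s - ?\<psi> t) / (s - t) \<le> (1 / g s - 1 / g t) / (s - t) * I2 U (g t)"
        using s by simp
    qed
  qed simp
qed

lemma flow_inner_bdist_ge:
  fixes U :: "'a::euclidean_space set"
  assumes U: "open U" "U \<noteq> {}" "bounded U" and g: "ode_solution U T g"
    and gf: "gradient_flow_solution U (J U) f (flow U T g)" and t: "0 < t" "t \<le> T"
  shows "t \<le> L2_inner U (\<lambda>x. inradius U - flow U T g t x) (bdist U)"
proof -
  let ?\<psi> = "\<lambda>s. L2_inner U (flow U T g s) (bdist U)"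
  have d: "bdist U \<in> L2 U" by (intro continuous_L2[OF U(1,3)] continuous_on_bdist)
  have r: "(\<lambda>x. inradius U) \<in> L2 U" by (intro continuous_L2[OF U(1,3)] continuous_on_const)
  have ul: "flow U T g s \<in> L2 U" if "0 \<le> s" for s using gf that by (simp add: gradient_flow_solution_def)
  have inc: "?\<psi> t - ?\<psi> a \<le> (-1) * (t - a)" if a: "0 < a" "a \<le> t" for a
  proof -
    have "L2_abs_continuous_on U a t (flow U T g)" using gf a by (simp add: gradient_flow_solution_def)
    then obtain m where m: "set_integrable lebesgue {a..t} m"
      "\<And>s s'. a \<le> s \<Longrightarrow> s \<le> s' \<Longrightarrow> s' \<le> t \<Longrightarrow>
       \<bar>?\<psi> s' - ?\<psi> s\<bar> \<le> L2_norm U (bdist U) * set_lebesgue_integral lebesgue {s..s'} m"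
      using a by (rule_tac L2_abs_continuous_inner_increment[of U a t "flow U T g" "bdist U"]) (auto intro: ul d)
    show ?thesis
    proof (rule derivative_le_AE_imp_increment_le[OF a(2) m(1)])
      show "?\<psi> s' - ?\<psi> s \<le> L2_norm U (bdist U) * set_lebesgue_integral lebesgue {s..s'} m"
        if "a \<le> s" "s \<le> s'" "s' \<le> t" for s s'
        using m(2)[OF that] by simp
      have "AE s in lebesgue. 0 < s \<longrightarrow>
          (\<exists>w. L2_has_derivative U (flow U T g) w s \<and> (\<lambda>x. - w x) \<in> subdifferential U (J U) (flow U T g s))"
        using gf by (simp add: gradient_flow_solution_def)
      then show "AE s in lebesgue. a < s \<and> s < t \<longrightarrow> (\<exists>D\<le>-1. (?\<psi> has_real_derivative D) (at s))"
      proof eventually_elim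
        case (elim s)
        show ?case
        proof
          assume s: "a < s \<and> s < t"
          then have s0: "0 < s" "s < T" using a t by auto
          \<comment> \<open>The gradient flow supplies the existence of the derivative at almost
            every time; the equation for \<open>g\<close> bounds its value.\<close>
          obtain w where w: "L2_has_derivative U (flow U T g) w s" using elim s0 by blast
          have "(?\<psi> has_real_derivative L2_inner U w (bdist U)) (at s)"
            by (rule L2_has_derivative_inner[OF w ul d s0(1)])
          with flow_inner_bdist_derivative[OF U g s0 this]
          show "\<exists>D\<le>-1. (?\<psi> has_real_derivative D) (at s)" by blast
        qed
      qed
    qed
  qed
  \<comment> \<open>The pointwise bound of the flow by the inradius replaces a limit of the pairing
    at time 0; starting at \<open>a\<close> loses at most \<open>a\<close>.\<close>
  have le: "?\<psi> a \<le> L2_inner U (\<lambda>x. inradius U) (bdist U)" if a: "0 < a" "a < T" for a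
    unfolding L2_inner_def
  proof (rule integral_mono[OF L2_mult_integrable L2_mult_integrable])
    show "flow U T g a x * bdist U x \<le> inradius U * bdist U x" for x
      using a by (intro mult_right_mono bdist_nonneg) (simp add: flow_eq[OF g])
  qed (use ul[of a] a d r in auto)
  have "t \<le> L2_inner U (\<lambda>x. inradius U) (bdist U) - ?\<psi> t + a" if a: "0 < a" for a
  proof (cases "a < t")
    case True
    then show ?thesis using inc[of a] le[of a] a t by simp
  next
    \<comment> \<open>A large \<open>a\<close> is covered by starting at \<open>t / 2\<close>, where
      the loss \<open>t / 2\<close> is still at most \<open>a\<close>.\<close>
    case False
    then show ?thesis using inc[of "t/2"] le[of "t/2"] a t by simp
  qed
  then have "t \<le> L2_inner U (\<lambda>x. inradius U) (bdist U) - ?\<psi> t" by (rule field_le_epsilon)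
  then show ?thesis using L2_inner_diff_left[OF r ul d] t by simp
qed

text \<open>From time \<open>T\<close> on everything is explicit. The flow equals
  \<open>bdist U\<close> at \<open>T\<close>, where the previous estimate gives the value
  \<open>T\<close>; afterwards its pairing with \<open>bdist U\<close> is \<open>N + T - t\<close>,
  decreasing at unit speed, so the lower bound keeps growing like \<open>t\<close>. After extinction
  both sides are 0.\<close>

lemma flow_attained:
  fixes U :: "'a::euclidean_space set"
  assumes U: "open U" "U \<noteq> {}" "bounded U" and T: "0 < T" and g: "ode_solution U T g"
    and gf: "gradient_flow_solution U (J U) f (flow U T g)" and t: "0 < t"
  shows "t * flow_Lipschitz_const U T g t \<le> L2_inner U (\<lambda>x. inradius U - flow U T g t x) (flow U T g t)"
proof -
  let ?L = "flow_Lipschitz_const U T g t" and ?r = "inradius U" and ?d = "bdist U"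
  have d: "?d \<in> L2 U" by (intro continuous_L2[OF U(1,3)] continuous_on_bdist)
  have r: "(\<lambda>x. ?r) \<in> L2 U" by (intro continuous_L2[OF U(1,3)] continuous_on_const)
  have ul: "flow U T g s \<in> L2 U" if "0 \<le> s" for s using gf that by (simp add: gradient_flow_solution_def)
  have L0: "0 \<le> ?L" by (rule flow_Lipschitz_const_nonneg[OF g t])
  have eq: "L2_inner U (\<lambda>x. ?r - flow U T g t x) (flow U T g t)
      = ?L * L2_inner U (\<lambda>x. ?r - flow U T g t x) ?d"
  proof -
    have "(?r - flow U T g t x) * flow U T g t x = ?L * ((?r - flow U T g t x) * ?d x)" for x
      using flow_eq[OF g t, of x] by (auto simp: flow_Lipschitz_const_def min_def)
    then have "L2_inner U (\<lambda>x. ?r - flow U T g t x) (flow U T g t)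
        = (LINT x|lebesgue_on U. ?L * ((?r - flow U T g t x) * ?d x))"
      unfolding L2_inner_def by (rule Bochner_Integration.integral_cong[OF refl])
    then show ?thesis by (simp add: L2_inner_def)
  qed
  show ?thesis
  proof (cases "?L = 0")
    case False
    have "t \<le> L2_inner U (\<lambda>x. ?r - flow U T g t x) ?d"
    proof (cases "t < T")
      case True
      then show ?thesis using flow_inner_bdist_ge[OF U g gf t] by simp
    next
      case F: False
      define N where "N = (L2_norm U ?d)\<^sup>2"
      have L: "?L = 1 / N * max (N + T - t) 0" using F by (simp add: flow_Lipschitz_const_def N_def)
      \<comment> \<open>A vanishing \<open>N\<close> would make the quotient 0 by convention, and a
        nonpositive \<open>N + T - t\<close> would make the maximum 0; \<open>?L \<noteq> 0\<close>
        excludes both.\<close>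
      have "N \<ge> 0" "N \<noteq> 0" using False L by (auto simp: N_def)
      then have N: "N > 0" by simp
      have pos: "N + T - t > 0" using False L by (auto simp: max_def split: if_splits)
      have Lt: "?L * N = N + T - t" using L N pos by simp
      have fT: "flow U T g T = ?d" using N flow_eq[OF g T] by (auto simp: fun_eq_iff flow_Lipschitz_const_def N_def[symmetric])
      have ft: "flow U T g t = (\<lambda>x. ?L * ?d x)" using F flow_eq[OF g t] by auto
      have dd: "L2_inner U ?d ?d = N" by (simp add: N_def L2_norm_sq)
      have "T \<le> L2_inner U (\<lambda>x. ?r) ?d - N"
        using flow_inner_bdist_ge[OF U g gf T] L2_inner_diff_left[OF r d d] by (simp add: fT dd)
      moreover have "L2_inner U (\<lambda>x. ?r - flow U T g t x) ?d = L2_inner U (\<lambda>x. ?r) ?d - ?L * N"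
        using L2_inner_diff_left[OF r L2_cmult[OF d] d] by (simp add: ft dd L2_inner_cmult_left)
      ultimately show ?thesis unfolding Lt by simp
    qed
    from mult_left_mono[OF this L0] show ?thesis unfolding eq by (simp add: mult.commute)
  qed (simp add: eq)
qed

theorem theorem3p11:
  fixes \<Omega> :: "'a::euclidean_space set" and tstar :: real and g :: "real \<Rightarrow> real"
  assumes "open \<Omega>" and "connected \<Omega>" and "\<Omega> \<noteq> {}" and "bounded \<Omega>"
    and "admits_perimeter_bound \<Omega>"
    and "tstar > 0"
    and "ode_solution \<Omega> tstar g"
    and "gradient_flow_solution \<Omega> (J \<Omega>) (\<lambda>x. inradius \<Omega>) (flow \<Omega> tstar g)"
  shows "\<forall>t>0. flow \<Omega> tstar g t \<in> minimizers \<Omega> (\<lambda>x. inradius \<Omega>) t \<and>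
           (\<forall>v\<in>minimizers \<Omega> (\<lambda>x. inradius \<Omega>) t. AE x in lebesgue_on \<Omega>. v x = flow \<Omega> tstar g t x)"
proof (intro allI impI)
  fix t :: real assume t: "t > 0"
  note U = assms(1,3,4) and g = assms(7) and gf = assms(8)
  have r: "(\<lambda>x. inradius \<Omega>) \<in> L2 \<Omega>" by (intro continuous_L2[OF assms(1,4)] continuous_on_const)
  note dual = gradient_flow_dual_bound[OF U gf r flow_W1inf0(1)[OF U g] _ _ t]
  note crit = minimizers_criterion[OF U r flow_W1inf0(1)[OF U g t] t flow_W1inf0(2)[OF U g t] dual
      flow_attained[OF U assms(6) g gf t]]
  show "flow \<Omega> tstar g t \<in> minimizers \<Omega> (\<lambda>x. inradius \<Omega>) t \<and>
      (\<forall>v\<in>minimizers \<Omega> (\<lambda>x. inradius \<Omega>) t. AE x in lebesgue_on \<Omega>. v x = flow \<Omega> tstar g t x)"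
    using crit by blast
qed

end
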